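(* Let $F:\mathcal X\to\mathcal Y$ be a Lipschitz continuous causal operator given by functions $f_t:\mathbb R^{nt}\times\Omega\to\mathbb R^m$, $t=1,\dots,T$ (see context), and for $t=1,\dots,T$ let $Y_t:\Omega\rightrightarrows\mathbb R^m$ and $X_t:\Omega\rightrightarrows\mathbb R^n$ be $\mathcal F_t$-measurable multifunctions with convex and closed values. If the system $$f_t(\zeta_{1:t-1},\xi,\omega)\in Y_t(\omega),\qquad \xi\in X_t(\omega)$$ admits complete subregular recourse (see context), then the system $$F_t(x_{1:t})\in Y_t\ \text{ a.s.},\qquad x_t\in X_t\ \text{ a.s.},\qquad t=1,\dots,T,$$ with unknown $x=(x_1,\dots,x_T)\in\mathcal X$, is subregular at every feasible point $\hat x=(\hat x_1,\dots,\hat x_T)\in\mathcal X$ (i.e., every $\hat x\in\mathcal X$ satisfying this system).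
   Context: $(\Omega,\mathcal F,P)$ is a probability space with filtration $\{\emptyset,\Omega\}=\mathcal F_1\subset\dots\subset\mathcal F_T=\mathcal F$, $p\in[1,\infty)$. $\mathcal X_t=L_p(\Omega,\mathcal F_t,P;\mathbb R^n)$, $\mathcal Y_t=L_p(\Omega,\mathcal F_t,P;\mathbb R^m)$, $\mathcal X=\mathcal X_1\times\dots\times\mathcal X_T$, $\mathcal Y=\mathcal Y_1\times\dots\times\mathcal Y_T$, with the $L_p$ norms; $x_{1:t}=(x_1,\dots,x_t)$. $F:\mathcal X\to\mathcal Y$ is causal if $F=(F_1,\dots,F_T)$ with $F_t(x)(\omega)=f_t(x_{1:t}(\omega),\omega)$ for functions $f_t:\mathbb R^{nt}\times\Omega\to\mathbb R^m$, each of which is superpositionally measurable (i.e., substituting a measurable function of $\omega$ for the first argument yields a measurable function of $\omega$); one also writes $F_t(x_{1:t})$ for $F_t(x)$. The multifunctions are identified with the sets $Y_t=\{y\in\mathcal Y_t: y(\omega)\in Y_t(\omega)\text{ a.s.}\}$ and $X_t=\{x\in\mathcal X_t:x(\omega)\in X_t(\omega)\text{ a.s.}\}$; $Y=Y_1\times\dots\times Y_T$, $X=X_1\times\dots\times X_T$. $\operatorname{dist}$ denotes distance to a set in a function space, $\mathsf d$ distance in a finite-dimensional space. Complete subregular recourse: there is a constant $C$ such that for every $t=1,\dots,T$, for almost all $\omega\in\Omega$, every $\zeta_{1:t-1}\in X_{1:t-1}(\omega)=X_1(\omega)\times\dots\times X_{t-1}(\omega)$ and every $\eta\in\mathbb R^n$,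 there exists $\xi$ with $f_t(\zeta_{1:t-1},\xi,\omega)\in Y_t(\omega)$, $\xi\in X_t(\omega)$ and $$\|\xi-\eta\|\le C\big(\mathsf d(f_t(\zeta_{1:t-1},\eta,\omega),Y_t(\omega))+\mathsf d(\eta,X_t(\omega))\big).$$ (For $t=1$ the parameter $\zeta_{1:t-1}$ is absent.) Subregularity: for a multifunction $\mathfrak H:\mathcal X\rightrightarrows\mathcal Z$ ($\mathcal Z$ Banach), the relation $0\in\mathfrak H(x)$ is subregular at $\hat x$ with $0\in\mathfrak H(\hat x)$ if there are $\delta>0$, $C>0$ such that for all $x$ with $\|x-\hat x\|\le\delta$ there is $\tilde x$ with $0\in\mathfrak H(\tilde x)$ and $\|\tilde x-x\|\le C\operatorname{dist}(0,\mathfrak H(x))$. For the system above, $\mathfrak H(x)=(F(x)-Y)\times(x-X)\subset\mathcal Y\times\mathcal X$, so that (up to a change of the constant) $\operatorname{dist}(0,\mathfrak H(x))$ may be taken to be $\sum_{t=1}^T\big(\operatorname{dist}(F_t(x_{1:t}),Y_t)+\operatorname{dist}(x_t,X_t)\big)$.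
   Formalization: The functions f_t are additionally assumed jointly measurable in (history, ω) with respect to the Borel sets times F_t; with superpositional measurability alone the claim is false. *)

theory Defs
  imports "HOL-Probability.Probability" "HOL-Library.Function_Algebras"
begin

text \<open>
  Elements of \<open>L\<^sub>p(\<Omega>, \<F>\<^sub>t, P)\<close> are represented by \<open>\<F>\<^sub>t\<close>-measurable functions, and a member
  \<open>x = (x\<^sub>1, \<dots>, x\<^sub>T)\<close> of a product of such spaces by a function of the time index whose values at
  indices outside \<open>{1..T}\<close> are irrelevant. Linear operations on these representatives are the
  pointwise ones.
\<close>

definition finite_filtration :: "'w measure \<Rightarrow> (nat \<Rightarrow> 'w measure) \<Rightarrow> nat \<Rightarrow> bool" where
  "finite_filtration M \<F> T \<longleftrightarrow>
     (\<forall>t\<in>{1..T}. subalgebra M (\<F> t)) \<and>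
     (\<forall>s t. 1 \<le> s \<and> s \<le> t \<and> t \<le> T \<longrightarrow> sets (\<F> s) \<subseteq> sets (\<F> t)) \<and>
     sets (\<F> 1) = {{}, space M} \<and>
     sets (\<F> T) = sets M"

definition Lp_norm :: "'w measure \<Rightarrow> real \<Rightarrow> ('w \<Rightarrow> 'a::euclidean_space) \<Rightarrow> real" where
  "Lp_norm M p x = (\<integral>\<omega>. norm (x \<omega>) powr p \<partial>M) powr (1 / p)"

definition Lp_space ::
  "'w measure \<Rightarrow> 'w measure \<Rightarrow> real \<Rightarrow> ('w \<Rightarrow> 'a::euclidean_space) set" where
  "Lp_space M G p = {x \<in> borel_measurable G. integrable M (\<lambda>\<omega>. norm (x \<omega>) powr p)}"

definition adapted_space ::
  "'w measure \<Rightarrow> (nat \<Rightarrow> 'w measure) \<Rightarrow> nat \<Rightarrow> real \<Rightarrow> (nat \<Rightarrow> 'w \<Rightarrow> 'a::euclidean_space) set" where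
  "adapted_space M \<F> T p = {x. \<forall>t\<in>{1..T}. x t \<in> Lp_space M (\<F> t) p}"

text \<open>
  Of the equivalent product norms we take the sum of the norms of the components, for which the
  distance to a product set is the sum of the distances to its factors.
\<close>

definition adapted_norm ::
  "'w measure \<Rightarrow> nat \<Rightarrow> real \<Rightarrow> (nat \<Rightarrow> 'w \<Rightarrow> 'a::euclidean_space) \<Rightarrow> real" where
  "adapted_norm M T p x = (\<Sum>t\<in>{1..T}. Lp_norm M p (x t))"

text \<open>
  The space \<open>\<real>\<^sup>n\<^sup>t\<close> of histories \<open>(\<zeta>\<^sub>1, \<dots>, \<zeta>\<^sub>t)\<close> is the extensional function space
  \<open>{1..t} \<rightarrow>\<^sub>E UNIV\<close> with the product Borel structure.
\<close>

abbreviation hist_borel :: "nat \<Rightarrow> (nat \<Rightarrow> 'a::euclidean_space) measure" where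
  "hist_borel t \<equiv> Pi\<^sub>M {1..t} (\<lambda>_. borel)"

definition superpositionally_measurable ::
  "'w measure \<Rightarrow> 'h measure \<Rightarrow> ('h \<Rightarrow> 'w \<Rightarrow> 'b::euclidean_space) \<Rightarrow> bool" where
  "superpositionally_measurable G H g \<longleftrightarrow>
     (\<forall>u\<in>measurable G H. (\<lambda>\<omega>. g (u \<omega>) \<omega>) \<in> borel_measurable G)"

definition causal_operator ::
  "'w measure \<Rightarrow> (nat \<Rightarrow> 'w measure) \<Rightarrow> nat \<Rightarrow> real \<Rightarrow>
   (nat \<Rightarrow> (nat \<Rightarrow> 'a::euclidean_space) \<Rightarrow> 'w \<Rightarrow> 'b::euclidean_space) \<Rightarrow>
   ((nat \<Rightarrow> 'w \<Rightarrow> 'a) \<Rightarrow> (nat \<Rightarrow> 'w \<Rightarrow> 'b)) \<Rightarrow> bool" where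
  "causal_operator M \<F> T p f F \<longleftrightarrow>
     (\<forall>t\<in>{1..T}. superpositionally_measurable (\<F> t) (hist_borel t) (f t)) \<and>
     (\<forall>x\<in>adapted_space M \<F> T p.
        F x \<in> adapted_space M \<F> T p \<and>
        (\<forall>t\<in>{1..T}. AE \<omega> in M. F x t \<omega> = f t (\<lambda>s\<in>{1..t}. x s \<omega>) \<omega>))"

text \<open>
  Joint measurability of the generating functions is required in addition to superpositional
  measurability, because the latter only sees the operator and does not control the functions
  themselves. Assuming the continuum hypothesis, let \<open>\<Omega> = [0,1]\<close> with Lebesgue measure, \<open>T = 2\<close>
  and \<open>\<F>\<^sub>2\<close> the Borel sets, and let the second stage depend on \<open>\<xi> = x\<^sub>2\<close> only: \<open>g(\<xi>) = min(\<xi>\<^sup>2, 1)\<close>, and enumerate the real Borel functions as \<open>u\<^sub>\<alpha>\<close> and \<open>\<Omega>\<close> as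
  \<open>\<omega>\<^sub>\<alpha>\<close> with \<open>\<alpha> < \<omega>\<^sub>1\<close>. Put \<open>f(\<xi>, \<omega>\<^sub>\<beta>) = g(\<xi>)\<close> if \<open>\<xi> = u\<^sub>\<alpha>(\<omega>\<^sub>\<beta>)\<close> for some \<open>\<alpha> < \<beta>\<close>, and
  \<open>f(\<xi>, \<omega>\<^sub>\<beta>) = 0\<close> otherwise. Every Borel superposition agrees with that of \<open>g\<close> outside a
  countable set, so the operator is Lipschitz, while every \<open>f(\<cdot>, \<omega>)\<close> vanishes on a dense set, so
  that \<open>f(\<xi>, \<omega>) = 0\<close> has complete subregular recourse. But \<open>g(x) = 0\<close> a.s. is not subregular
  at \<open>0\<close>.
\<close>

definition jointly_measurable ::
  "(nat \<Rightarrow> 'w measure) \<Rightarrow> nat \<Rightarrow>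
   (nat \<Rightarrow> (nat \<Rightarrow> 'a::euclidean_space) \<Rightarrow> 'w \<Rightarrow> 'b::euclidean_space) \<Rightarrow> bool" where
  "jointly_measurable \<F> T f \<longleftrightarrow>
     (\<forall>t\<in>{1..T}. (\<lambda>(\<zeta>, \<omega>). f t \<zeta> \<omega>) \<in> borel_measurable (hist_borel t \<Otimes>\<^sub>M \<F> t))"

definition lipschitz_operator ::
  "'w measure \<Rightarrow> (nat \<Rightarrow> 'w measure) \<Rightarrow> nat \<Rightarrow> real \<Rightarrow>
   ((nat \<Rightarrow> 'w \<Rightarrow> 'a::euclidean_space) \<Rightarrow> (nat \<Rightarrow> 'w \<Rightarrow> 'b::euclidean_space)) \<Rightarrow> bool" where
  "lipschitz_operator M \<F> T p F \<longleftrightarrow>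
     (\<exists>L\<ge>0. \<forall>x\<in>adapted_space M \<F> T p. \<forall>x'\<in>adapted_space M \<F> T p.
        adapted_norm M T p (F x - F x') \<le> L * adapted_norm M T p (x - x'))"

definition measurable_multifunction :: "'w measure \<Rightarrow> ('w \<Rightarrow> 'a::topological_space set) \<Rightarrow> bool" where
  "measurable_multifunction G S \<longleftrightarrow>
     (\<forall>U. open U \<longrightarrow> {\<omega> \<in> space G. S \<omega> \<inter> U \<noteq> {}} \<in> sets G)"

definition adapted_selections ::
  "'w measure \<Rightarrow> (nat \<Rightarrow> 'w measure) \<Rightarrow> nat \<Rightarrow> real \<Rightarrow> (nat \<Rightarrow> 'w \<Rightarrow> 'a::euclidean_space set) \<Rightarrow>
   (nat \<Rightarrow> 'w \<Rightarrow> 'a) set" where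
  "adapted_selections M \<F> T p S =
     {x \<in> adapted_space M \<F> T p. \<forall>t\<in>{1..T}. AE \<omega> in M. x t \<omega> \<in> S t \<omega>}"

text \<open>
  The value \<open>infdist x {} = 0\<close> is harmless here: the requirements on \<open>\<xi>\<close> cannot be met when
  \<open>Y t \<omega>\<close> or \<open>X t \<omega>\<close> is empty.
\<close>

definition complete_subregular_recourse ::
  "'w measure \<Rightarrow> nat \<Rightarrow>
   (nat \<Rightarrow> (nat \<Rightarrow> 'a::euclidean_space) \<Rightarrow> 'w \<Rightarrow> 'b::euclidean_space) \<Rightarrow>
   (nat \<Rightarrow> 'w \<Rightarrow> 'b set) \<Rightarrow> (nat \<Rightarrow> 'w \<Rightarrow> 'a set) \<Rightarrow> bool" where
  "complete_subregular_recourse M T f Y X \<longleftrightarrow>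
     (\<exists>C. \<forall>t\<in>{1..T}. AE \<omega> in M. \<forall>\<zeta>\<in>(\<Pi>\<^sub>E s\<in>{1..<t}. X s \<omega>). \<forall>\<eta>. \<exists>\<xi>.
        f t (\<zeta>(t := \<xi>)) \<omega> \<in> Y t \<omega> \<and> \<xi> \<in> X t \<omega> \<and>
        norm (\<xi> - \<eta>) \<le> C * (infdist (f t (\<zeta>(t := \<eta>)) \<omega>) (Y t \<omega>) + infdist \<eta> (X t \<omega>)))"

text \<open>
  Subregularity at \<open>xh\<close> of the relation \<open>0 \<in> H x\<close> for a multifunction \<open>H\<close> on the space \<open>A\<close> with
  norm \<open>N\<close>, whose values lie in a space with norm \<open>N'\<close>. The infimum is the distance from \<open>0\<close> to
  \<open>H x\<close>, taken in the extended nonnegative reals so that it is infinite for an empty value.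
\<close>

definition subregular_at ::
  "'x::ab_group_add set \<Rightarrow> ('x \<Rightarrow> real) \<Rightarrow> ('z::ab_group_add \<Rightarrow> real) \<Rightarrow> ('x \<Rightarrow> 'z set) \<Rightarrow> 'x \<Rightarrow> bool"
where
  "subregular_at A N N' H xh \<longleftrightarrow>
     xh \<in> A \<and> 0 \<in> H xh \<and>
     (\<exists>\<delta>>0. \<exists>C>0. \<forall>x\<in>A. N (x - xh) \<le> \<delta> \<longrightarrow>
        (\<exists>x'\<in>A. 0 \<in> H x' \<and>
           ennreal (N (x' - x)) \<le> ennreal C * (INF z\<in>H x. ennreal (N' z))))"

definition system_multifunction ::
  "'w measure \<Rightarrow> (nat \<Rightarrow> 'w measure) \<Rightarrow> nat \<Rightarrow> real \<Rightarrow>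
   ((nat \<Rightarrow> 'w \<Rightarrow> 'a::euclidean_space) \<Rightarrow> (nat \<Rightarrow> 'w \<Rightarrow> 'b::euclidean_space)) \<Rightarrow>
   (nat \<Rightarrow> 'w \<Rightarrow> 'b set) \<Rightarrow> (nat \<Rightarrow> 'w \<Rightarrow> 'a set) \<Rightarrow> (nat \<Rightarrow> 'w \<Rightarrow> 'a) \<Rightarrow>
   ((nat \<Rightarrow> 'w \<Rightarrow> 'b) \<times> (nat \<Rightarrow> 'w \<Rightarrow> 'a)) set" where
  "system_multifunction M \<F> T p F Y X x =
     {F x - y | y. y \<in> adapted_selections M \<F> T p Y} \<times>
     {x - x' | x'. x' \<in> adapted_selections M \<F> T p X}"

definition system_subregular_at ::
  "'w measure \<Rightarrow> (nat \<Rightarrow> 'w measure) \<Rightarrow> nat \<Rightarrow> real \<Rightarrow>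
   ((nat \<Rightarrow> 'w \<Rightarrow> 'a::euclidean_space) \<Rightarrow> (nat \<Rightarrow> 'w \<Rightarrow> 'b::euclidean_space)) \<Rightarrow>
   (nat \<Rightarrow> 'w \<Rightarrow> 'b set) \<Rightarrow> (nat \<Rightarrow> 'w \<Rightarrow> 'a set) \<Rightarrow> (nat \<Rightarrow> 'w \<Rightarrow> 'a) \<Rightarrow> bool" where
  "system_subregular_at M \<F> T p F Y X =
     subregular_at (adapted_space M \<F> T p) (adapted_norm M T p)
       (\<lambda>(v, w). adapted_norm M T p v + adapted_norm M T p w)
       (system_multifunction M \<F> T p F Y X)"

end

theory Submission
  imports Defs
begin

text \<open>
  A point \<open>x\<close> is repaired stage by stage. Once the components before stage
  \<open>t\<close> have been replaced by feasible ones, complete subregular recourse offers, for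
  almost every \<open>\<omega>\<close>, a feasible value \<open>\<xi>\<close> whose distance to
  \<open>x\<^sub>t(\<omega>)\<close> is controlled by the residual of stage \<open>t\<close> at
  the partially repaired point. If the choice of \<open>\<xi>\<close> can be made
  \<open>\<F>\<^sub>t\<close>-measurably, it defines the next component. Lipschitz continuity of
  the operator bounds the residual at the partially repaired point by that at \<open>x\<close>
  plus a multiple of the corrections already made, so that after \<open>T\<close> stages the total
  correction is at most a constant times the distance of \<open>0\<close> from the value of the
  system at \<open>x\<close> (\<open>recourse_correction\<close>). The estimate is global in
  \<open>x\<close>; the reference point enters by providing one pair of
  \<open>p\<close>-integrable selections.

  The substance of the proof is the measurable choice. The generating functions are only jointly
  measurable, so the set of admissible pairs \<open>(\<omega>, \<xi>)\<close> is
  product-measurable but its sections need not be closed, and the \<sigma>-algebra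
  \<open>\<F>\<^sub>t\<close> need not be complete. The theorem
  \<open>measurable_selection\<close> covers this situation: every product-measurable set arises
  from closed blocks by the Souslin operation (\<open>souslin_if_pair_measurable\<close>),
  Choquet's argument exhausts its projection, up to small measure, by projections of measurable
  compact-valued multifunctions (\<open>souslin_capacity\<close>), and such multifunctions have
  measurable selections (\<open>compact_measurable_selection\<close>).
\<close>

section \<open>Souslin sets over a measurable space\<close>

text \<open>
  Random closed sets with countably many values. They form the class of building blocks below
  because they are trivially stable under finite intersections, a property that general measurable
  closed-valued multifunctions have only by a theorem.
\<close>

definition simple_closed :: "'w measure \<Rightarrow> ('w \<Rightarrow> 'a::topological_space set) \<Rightarrow> bool" where
  "simple_closed G S \<longleftrightarrow>
     (\<exists>g\<in>measurable G (count_space (UNIV::nat set)). \<exists>C. (\<forall>j. closed (C j)) \<and> S = (\<lambda>\<omega>. C (g \<omega>)))"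

lemma simple_closed_const: "closed C \<Longrightarrow> simple_closed G (\<lambda>_. C)"
  unfolding simple_closed_def by (rule bexI[of _ "\<lambda>_. 0"]) (auto intro!: exI[of _ "\<lambda>_. C"])

lemma simple_closed_If:
  assumes "A \<in> sets G" "closed C" "closed D"
  shows "simple_closed G (\<lambda>\<omega>. if \<omega> \<in> A then C else D)"
  unfolding simple_closed_def
proof (intro bexI exI conjI)
  show "(\<lambda>\<omega>. if \<omega> \<in> A then 0 else 1::nat) \<in> measurable G (count_space UNIV)"
    using assms(1) by measurable
  show "\<forall>j::nat. closed (if j = 0 then C else D)" using assms by auto
qed (auto simp: fun_eq_iff)

lemma simple_closed_combine:
  assumes "simple_closed G S" "simple_closed G S'"
    and op: "\<And>C D. closed C \<Longrightarrow> closed D \<Longrightarrow> closed (h C D)"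
  shows "simple_closed G (\<lambda>\<omega>. h (S \<omega>) (S' \<omega>))"
proof -
  obtain g C g' C' where g: "g \<in> measurable G (count_space UNIV)" "g' \<in> measurable G (count_space UNIV)"
    and C: "\<forall>j::nat. closed (C j)" "\<forall>j::nat. closed (C' j)" and S: "S = (\<lambda>\<omega>. C (g \<omega>))" "S' = (\<lambda>\<omega>. C' (g' \<omega>))"
    using assms unfolding simple_closed_def by metis
  have "(\<lambda>\<omega>. prod_encode (g \<omega>, g' \<omega>)) \<in> measurable G (count_space UNIV)"
    using g by measurable
  then show ?thesis
    unfolding simple_closed_def
    by (rule bexI[rotated])
      (rule exI[of _ "\<lambda>j. h (C (fst (prod_decode j))) (C' (snd (prod_decode j)))"], use C op S in auto)
qed

lemma simple_closed_UN:
  assumes "finite I" "\<And>i. i \<in> I \<Longrightarrow> simple_closed G (S i)"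
  shows "simple_closed G (\<lambda>\<omega>. \<Union>i\<in>I. S i \<omega>)"
  using assms
proof (induction I)
  case (insert i I)
  then show ?case
    using simple_closed_combine[of G "S i" "\<lambda>\<omega>. \<Union>i\<in>I. S i \<omega>" "(\<union>)"] by (auto simp: closed_Un)
qed (auto simp: simple_closed_const)

lemma simple_closed_INT:
  assumes "finite I" "\<And>i. i \<in> I \<Longrightarrow> simple_closed G (S i)"
  shows "simple_closed G (\<lambda>\<omega>. \<Inter>i\<in>I. S i \<omega>)"
  using assms
proof (induction I)
  case (insert i I)
  then show ?case
    using simple_closed_combine[of G "S i" "\<lambda>\<omega>. \<Inter>i\<in>I. S i \<omega>" "(\<inter>)"] by (auto simp: closed_Int)
qed (auto simp: simple_closed_const)

lemma simple_closed_closed: "simple_closed G S \<Longrightarrow> closed (S \<omega>)"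
  unfolding simple_closed_def by auto

lemma simple_closed_hit:
  assumes "simple_closed G S"
  shows "{\<omega> \<in> space G. S \<omega> \<inter> C \<noteq> {}} \<in> sets G"
proof -
  obtain g D where g: "g \<in> measurable G (count_space (UNIV::nat set))" and S: "S = (\<lambda>\<omega>. D (g \<omega>))"
    using assms unfolding simple_closed_def by blast
  have "{\<omega> \<in> space G. S \<omega> \<inter> C \<noteq> {}} = g -` {j. D j \<inter> C \<noteq> {}} \<inter> space G"
    using S by auto
  then show ?thesis using measurable_sets[OF g, of "{j. D j \<inter> C \<noteq> {}}"] by (simp only: sets_count_space Pow_UNIV UNIV_I)
qed

text \<open>
  A Souslin operation is usually indexed by finite sequences of naturals. Here a block depends on
  an infinite sequence \<open>\<sigma>\<close>, of which it may only inspect a finite part bounded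
  independently of \<open>\<sigma>\<close>; the blocks need not decrease. In this form countable
  unions and intersections only require a recoding of \<open>\<sigma>\<close>.
\<close>

definition souslin_scheme :: "'w measure \<Rightarrow> (nat \<Rightarrow> (nat \<Rightarrow> nat) \<Rightarrow> 'w \<Rightarrow> 'a::topological_space set) \<Rightarrow> bool" where
  "souslin_scheme G K \<longleftrightarrow>
     (\<forall>k \<sigma>. simple_closed G (K k \<sigma>)) \<and>
     (\<forall>k. \<exists>N. \<forall>\<sigma> \<tau>. (\<forall>i<N. \<sigma> i = \<tau> i) \<longrightarrow> K k \<sigma> = K k \<tau>)"

definition souslin :: "'w measure \<Rightarrow> ('w \<times> 'a::topological_space) set \<Rightarrow> bool" where
  "souslin G B \<longleftrightarrow>
     (\<exists>K. souslin_scheme G K \<and>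
        (\<forall>\<omega>\<in>space G. \<forall>\<xi>. (\<omega>, \<xi>) \<in> B \<longleftrightarrow> (\<exists>\<sigma>. \<forall>k. \<xi> \<in> K k \<sigma> \<omega>)))"

lemma souslin_schemeI:
  assumes "\<And>k \<sigma>. simple_closed G (K k \<sigma>)"
    and "\<And>k \<sigma> \<tau>. (\<And>i. i < N k \<Longrightarrow> \<sigma> i = \<tau> i) \<Longrightarrow> K k \<sigma> = K k \<tau>"
  shows "souslin_scheme G K"
  using assms unfolding souslin_scheme_def by metis

lemma souslin_scheme_simple: "souslin_scheme G K \<Longrightarrow> simple_closed G (K k \<sigma>)"
  unfolding souslin_scheme_def by blast

lemma souslin_scheme_local:
  assumes "souslin_scheme G K"
  obtains N where "\<And>k \<sigma> \<tau>. \<forall>i<N k. \<sigma> i = \<tau> i \<Longrightarrow> K k \<sigma> = K k \<tau>"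
  using assms unfolding souslin_scheme_def by metis

lemma souslin_simple:
  assumes "simple_closed G S" "\<And>\<omega> \<xi>. \<omega> \<in> space G \<Longrightarrow> (\<omega>, \<xi>) \<in> B \<longleftrightarrow> \<xi> \<in> S \<omega>"
  shows "souslin G B"
  unfolding souslin_def
  by (rule exI[of _ "\<lambda>_ _. S"]) (use assms in \<open>auto intro: souslin_schemeI\<close>)

text \<open>
  The first term of the sequence names the member of the union. A block belonging to another
  member is replaced by the whole space, so that how much of \<open>\<sigma>\<close> a block
  inspects stays bounded uniformly.
\<close>

lemma souslin_UN:
  assumes "\<And>i::nat. souslin G (B i)"
  shows "souslin G (\<Union>i. B i)"
proof -
  obtain K where K: "\<And>i. souslin_scheme G (K i)"
    and B: "\<And>i \<omega> \<xi>. \<omega> \<in> space G \<Longrightarrow> (\<omega>, \<xi>) \<in> B i \<longleftrightarrow> (\<exists>\<sigma>. \<forall>k. \<xi> \<in> K i k \<sigma> \<omega>)"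
    using assms unfolding souslin_def by metis
  obtain N where sc: "\<And>i k \<sigma>. simple_closed G (K i k \<sigma>)"
    and N: "\<And>i k \<sigma> \<tau>. (\<And>j. j < N i k \<Longrightarrow> \<sigma> j = \<tau> j) \<Longrightarrow> K i k \<sigma> = K i k \<tau>"
    using K unfolding souslin_scheme_def by metis
  define L where "L k \<sigma> = (case prod_decode k of (i, l) \<Rightarrow>
      if \<sigma> 0 = i then K i l (\<lambda>j. \<sigma> (Suc j)) else (\<lambda>_. UNIV))" for k \<sigma>
  have "souslin_scheme G L"
  proof (rule souslin_schemeI)
    show "simple_closed G (L k \<sigma>)" for k \<sigma>
      using sc by (auto simp: L_def simple_closed_const split: prod.split)
    fix k and \<sigma> \<tau> :: "nat \<Rightarrow> nat"
    assume *: "\<And>i. i < (case prod_decode k of (i, l) \<Rightarrow> Suc (N i l)) \<Longrightarrow> \<sigma> i = \<tau> i"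
    obtain i l where k: "prod_decode k = (i, l)" by fastforce
    have "\<sigma> 0 = \<tau> 0" "K i l (\<lambda>j. \<sigma> (Suc j)) = K i l (\<lambda>j. \<tau> (Suc j))"
      using * k by (auto intro: N)
    then show "L k \<sigma> = L k \<tau>" by (simp add: L_def k)
  qed
  moreover have "(\<omega>, \<xi>) \<in> (\<Union>i. B i) \<longleftrightarrow> (\<exists>\<sigma>. \<forall>k. \<xi> \<in> L k \<sigma> \<omega>)" if \<omega>: "\<omega> \<in> space G" for \<omega> \<xi>
  proof
    assume "(\<omega>, \<xi>) \<in> (\<Union>i. B i)"
    then obtain i \<sigma> where "\<forall>k. \<xi> \<in> K i k \<sigma> \<omega>" using B[OF \<omega>] by blast
    then have "\<forall>k. \<xi> \<in> L k (case_nat i \<sigma>) \<omega>" by (auto simp: L_def split: prod.split)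
    then show "\<exists>\<sigma>. \<forall>k. \<xi> \<in> L k \<sigma> \<omega>" by blast
  next
    assume "\<exists>\<sigma>. \<forall>k. \<xi> \<in> L k \<sigma> \<omega>"
    then obtain \<sigma> where \<sigma>: "\<And>k. \<xi> \<in> L k \<sigma> \<omega>" by blast
    have "\<xi> \<in> K (\<sigma> 0) l (\<lambda>j. \<sigma> (Suc j)) \<omega>" for l
      using \<sigma>[of "prod_encode (\<sigma> 0, l)"] by (simp add: L_def)
    then show "(\<omega>, \<xi>) \<in> (\<Union>i. B i)" using B[OF \<omega>] by blast
  qed
  ultimately show ?thesis unfolding souslin_def by blast
qed

text \<open>
  Through the pairing function one sequence codes a whole sequence of sequences, one for each
  member.
\<close>

lemma souslin_INT:
  assumes "\<And>i::nat. souslin G (B i)"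
  shows "souslin G (\<Inter>i. B i)"
proof -
  obtain K where K: "\<And>i. souslin_scheme G (K i)"
    and B: "\<And>i \<omega> \<xi>. \<omega> \<in> space G \<Longrightarrow> (\<omega>, \<xi>) \<in> B i \<longleftrightarrow> (\<exists>\<sigma>. \<forall>k. \<xi> \<in> K i k \<sigma> \<omega>)"
    using assms unfolding souslin_def by metis
  obtain N where sc: "\<And>i k \<sigma>. simple_closed G (K i k \<sigma>)"
    and N: "\<And>i k \<sigma> \<tau>. (\<And>j. j < N i k \<Longrightarrow> \<sigma> j = \<tau> j) \<Longrightarrow> K i k \<sigma> = K i k \<tau>"
    using K unfolding souslin_scheme_def by metis
  define L where "L k \<sigma> = (case prod_decode k of (i, l) \<Rightarrow> K i l (\<lambda>j. \<sigma> (prod_encode (i, j))))" for k \<sigma>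
  have "souslin_scheme G L"
  proof (rule souslin_schemeI)
    show "simple_closed G (L k \<sigma>)" for k \<sigma>
      using sc by (auto simp: L_def split: prod.split)
    fix k and \<sigma> \<tau> :: "nat \<Rightarrow> nat"
    assume *: "\<And>n. n < (case prod_decode k of (i, l) \<Rightarrow> \<Sum>j<N i l. Suc (prod_encode (i, j))) \<Longrightarrow> \<sigma> n = \<tau> n"
    obtain i l where k: "prod_decode k = (i, l)" by fastforce
    have "prod_encode (i, j) < (\<Sum>j<N i l. Suc (prod_encode (i, j)))" if "j < N i l" for j
      using member_le_sum[of j "{..<N i l}" "\<lambda>j. Suc (prod_encode (i, j))"] that by auto
    then have "K i l (\<lambda>j. \<sigma> (prod_encode (i, j))) = K i l (\<lambda>j. \<tau> (prod_encode (i, j)))"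
      using * k by (auto intro: N)
    then show "L k \<sigma> = L k \<tau>" by (simp add: L_def k)
  qed
  moreover have "(\<omega>, \<xi>) \<in> (\<Inter>i. B i) \<longleftrightarrow> (\<exists>\<sigma>. \<forall>k. \<xi> \<in> L k \<sigma> \<omega>)" if \<omega>: "\<omega> \<in> space G" for \<omega> \<xi>
  proof
    assume "(\<omega>, \<xi>) \<in> (\<Inter>i. B i)"
    then obtain \<sigma> where "\<And>i k. \<xi> \<in> K i k (\<sigma> i) \<omega>" using B[OF \<omega>] by (metis INT_E UNIV_I)
    then have "\<forall>k. \<xi> \<in> L k (\<lambda>n. case prod_decode n of (i, j) \<Rightarrow> \<sigma> i j) \<omega>"
      by (auto simp: L_def split: prod.split)
    then show "\<exists>\<sigma>. \<forall>k. \<xi> \<in> L k \<sigma> \<omega>" by blast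
  next
    assume "\<exists>\<sigma>. \<forall>k. \<xi> \<in> L k \<sigma> \<omega>"
    then obtain \<sigma> where \<sigma>: "\<And>k. \<xi> \<in> L k \<sigma> \<omega>" by blast
    have "\<xi> \<in> K i l (\<lambda>j. \<sigma> (prod_encode (i, j))) \<omega>" for i l
      using \<sigma>[of "prod_encode (i, l)"] by (simp add: L_def)
    then show "(\<omega>, \<xi>) \<in> (\<Inter>i. B i)" using B[OF \<omega>] by blast
  qed
  ultimately show ?thesis unfolding souslin_def by blast
qed

lemma souslin_open:
  fixes U :: "'a::euclidean_space set"
  assumes "open U"
  shows "souslin G (space G \<times> U)"
proof -
  have "fsigma_in euclidean U"
    using assms open_imp_fsigma_in[of euclidean U] by (simp add: metrizable_space_euclidean)
  then obtain C where C: "\<And>n::nat. closed (C n)" and U: "\<Union>(range C) = U"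
    unfolding fsigma_in_ascending by auto
  have "souslin G (space G \<times> C n)" for n
    by (rule souslin_simple[of _ "\<lambda>_. C n"]) (use C in \<open>auto simp: simple_closed_const\<close>)
  then have "souslin G (\<Union>n. space G \<times> C n)"
    by (rule souslin_UN)
  moreover have "(\<Union>n. space G \<times> C n) = space G \<times> U" using U by auto
  ultimately show ?thesis by simp
qed

text \<open>
  A complement of a Souslin set is in general not Souslin. The Souslin sets whose complement is
  Souslin as well form a \<sigma>-algebra, and it contains the measurable rectangles because open
  sets are countable unions of closed ones.
\<close>

lemma souslin_if_pair_measurable:
  fixes B :: "('w \<times> 'a::euclidean_space) set"
  assumes "B \<in> sets (G \<Otimes>\<^sub>M borel)"
  shows "souslin G B"
proof -
  let ?\<Omega> = "space G \<times> (UNIV :: 'a set)"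
  define \<D> where "\<D> = {B. B \<subseteq> ?\<Omega> \<and> souslin G B \<and> souslin G (?\<Omega> - B)}"
  have empty: "souslin G {}"
    by (rule souslin_simple[of _ "\<lambda>_. {}"]) (auto simp: simple_closed_const)
  have D: "sigma_algebra ?\<Omega> \<D>"
  proof (subst sigma_algebra_iff2, safe)
    fix B :: "nat \<Rightarrow> _" assume "range B \<subseteq> \<D>"
    then have "B i \<subseteq> ?\<Omega>" "souslin G (B i)" "souslin G (?\<Omega> - B i)" for i
      by (auto simp: \<D>_def)
    moreover have "?\<Omega> - (\<Union>i. B i) = (\<Inter>i. ?\<Omega> - B i)" by auto
    ultimately show "(\<Union>i. B i) \<in> \<D>"
      using souslin_UN[of G B] souslin_INT[of G "\<lambda>i. ?\<Omega> - B i"] unfolding \<D>_def by auto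
  next
    show "{} \<in> \<D>" unfolding \<D>_def
      using souslin_simple[of G "\<lambda>_. UNIV" ?\<Omega>] empty by (auto simp: simple_closed_const)
  qed (auto simp: \<D>_def double_diff)
  interpret D: sigma_algebra ?\<Omega> \<D> by (rule D)
  have fst: "A \<times> UNIV \<in> \<D>" if A: "A \<in> sets G" for A
  proof -
    have "souslin G (A \<times> (UNIV :: 'a set))"
      by (rule souslin_simple[OF simple_closed_If[OF A closed_UNIV closed_empty]]) auto
    moreover have "souslin G (?\<Omega> - A \<times> UNIV)"
      by (rule souslin_simple[OF simple_closed_If[OF A closed_empty closed_UNIV]]) auto
    ultimately show ?thesis using sets.sets_into_space[OF A] by (auto simp: \<D>_def)
  qed
  have snd: "space G \<times> b \<in> \<D>" if "b \<in> sets borel" for b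
  proof -
    have "b \<in> sigma_sets UNIV (Collect closed)"
      using that by (simp add: borel_eq_closed)
    then show ?thesis
    proof induction
      case (Basic C)
      have "souslin G (space G \<times> C)"
        by (rule souslin_simple[of _ "\<lambda>_. C"]) (use Basic in \<open>auto simp: simple_closed_const\<close>)
      moreover have "?\<Omega> - space G \<times> C = space G \<times> (- C)" by auto
      ultimately show ?case using souslin_open[of "- C" G] Basic by (auto simp: \<D>_def)
    next
      case (Compl a)
      have "space G \<times> (UNIV - a) = ?\<Omega> - space G \<times> a" by auto
      then show ?case using Compl by auto
    next
      case (Union a)
      have "space G \<times> \<Union>(range a) = (\<Union>i. space G \<times> a i)" by auto
      then show ?case using Union by auto
    qed auto
  qed
  have "{a \<times> b | a b. a \<in> sets G \<and> b \<in> sets (borel :: 'a measure)} \<subseteq> \<D>"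
  proof safe
    fix a and b :: "'a set" assume "a \<in> sets G" "b \<in> sets borel"
    moreover have "a \<times> b = (a \<times> UNIV) \<inter> (space G \<times> b)"
      using sets.sets_into_space[OF \<open>a \<in> sets G\<close>] by auto
    ultimately show "a \<times> b \<in> \<D>" using fst snd by auto
  qed
  then have "sets (G \<Otimes>\<^sub>M (borel :: 'a measure)) \<subseteq> \<D>"
    unfolding sets_pair_measure by (simp add: D.sigma_sets_subset)
  then show ?thesis using assms by (auto simp: \<D>_def)
qed

section \<open>Capacitability of projections\<close>

text \<open>
  Dependent choice of the terms of one sequence, for a property of its initial segments.
\<close>

lemma prefix_choice:
  fixes P :: "nat \<Rightarrow> (nat \<Rightarrow> nat) \<Rightarrow> bool"
  assumes start: "P 0 (\<lambda>_. 0)"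
    and step: "\<And>k s. P k s \<Longrightarrow> \<exists>v. P (Suc k) (s(k := v))"
    and local: "\<And>k s s'. P k s \<Longrightarrow> (\<And>i. i < k \<Longrightarrow> s i = s' i) \<Longrightarrow> P k s'"
  obtains s where "\<And>k. P k s"
proof -
  obtain S where S: "\<And>k. P k (S k)" "\<And>k. \<exists>v. S (Suc k) = (S k)(k := v)"
  proof -
    have "\<exists>S. \<forall>k. P k (S k) \<and> (\<exists>v. S (Suc k) = (S k)(k := v))"
      by (rule dependent_nat_choice) (use start step in blast)+
    then show ?thesis using that by blast
  qed
  \<comment> \<open>Once chosen, a term is never changed, so the diagonal sequence extends every prefix.\<close>
  have stable: "S (k + d) i = S k i" if "i < k" for i k d
  proof (induction d)
    case (Suc d)
    obtain v where "S (Suc (k + d)) = (S (k + d))(k + d := v)" using S(2) by blast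
    then show ?case using Suc that by simp
  qed simp
  have "P k (\<lambda>i. S (Suc i) i)" for k
  proof (rule local[OF S(1)])
    fix i assume "i < k"
    then show "S k i = S (Suc i) i" using stable[of i "Suc i" "k - Suc i"] by simp
  qed
  then show ?thesis using that by blast
qed

text \<open>
  Compactness of the sequences bounded by \<open>m\<close>: by the pigeonhole principle, one of
  the finitely many values admissible for the next term must leave all finite sets of conditions
  satisfiable.
\<close>

lemma bounded_koenig:
  fixes Q :: "nat \<Rightarrow> (nat \<Rightarrow> nat) \<Rightarrow> bool"
  assumes local: "\<And>k \<sigma> \<tau>. Q k \<sigma> \<Longrightarrow> \<forall>i<N k. \<sigma> i = \<tau> i \<Longrightarrow> Q k \<tau>"
    and fin: "\<And>k. \<exists>\<sigma>. (\<forall>i. \<sigma> i \<le> m i) \<and> (\<forall>l<k. Q l \<sigma>)"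
  shows "\<exists>\<sigma>. (\<forall>i. \<sigma> i \<le> m i) \<and> (\<forall>k. Q k \<sigma>)"
proof -
  define A where "A k \<sigma> \<longleftrightarrow> (\<forall>i. \<sigma> i \<le> m i) \<and> (\<forall>l<k. Q l \<sigma>)" for k \<sigma>
  define E where "E n s \<sigma> \<longleftrightarrow> (\<forall>i<n. \<sigma> i = s i)" for n and s \<sigma> :: "nat \<Rightarrow> nat"
  define P where "P n s \<longleftrightarrow> (\<forall>k. \<exists>\<sigma>. A k \<sigma> \<and> E n s \<sigma>)" for n s
  obtain s where s: "\<And>n. P n s"
  proof (rule prefix_choice[of P])
    show "P 0 (\<lambda>_. 0)" using fin by (simp add: P_def A_def E_def)
    show "P k s'" if "P k s" "\<And>i. i < k \<Longrightarrow> s i = s' i" for k s s'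
    proof -
      have "E k s = E k s'" using that(2) by (auto simp: E_def fun_eq_iff)
      with that(1) show ?thesis by (simp add: P_def)
    qed
    fix n s assume Pn: "P n s"
    show "\<exists>v. P (Suc n) (s(n := v))"
    proof (rule ccontr)
      assume "\<nexists>v. P (Suc n) (s(n := v))"
      then have "\<forall>v. \<exists>k. \<forall>\<sigma>. A k \<sigma> \<longrightarrow> \<not> E (Suc n) (s(n := v)) \<sigma>"
        unfolding P_def by blast
      then obtain h where h: "\<And>v \<sigma>. A (h v) \<sigma> \<Longrightarrow> \<not> E (Suc n) (s(n := v)) \<sigma>"
        by metis
      \<comment> \<open>The sum dominates \<open>h v\<close> for each of the finitely many candidates \<open>v\<close>, one of which is \<open>\<sigma> n\<close>.\<close>
      obtain \<sigma> where \<sigma>: "A (\<Sum>v\<le>m n. h v) \<sigma>" "E n s \<sigma>"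
        using Pn unfolding P_def by blast
      have "h (\<sigma> n) \<le> (\<Sum>v\<le>m n. h v)"
        using \<sigma>(1) by (intro member_le_sum) (auto simp: A_def)
      then have "A (h (\<sigma> n)) \<sigma>" using \<sigma>(1) by (simp add: A_def)
      then have "\<not> E (Suc n) (s(n := \<sigma> n)) \<sigma>" by (rule h)
      then show False using \<sigma>(2) by (auto simp: E_def less_Suc_eq)
    qed
  qed blast
  have "s i \<le> m i" for i
  proof -
    obtain \<sigma> where "A 0 \<sigma>" "E (Suc i) s \<sigma>"
      using s[of "Suc i"] unfolding P_def by blast
    then show ?thesis by (metis A_def E_def lessI)
  qed
  moreover have "Q k s" for k
  proof -
    obtain \<sigma> where "A (Suc k) \<sigma>" "E (N k) s \<sigma>"
      using s[of "N k"] unfolding P_def by blast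
    then show ?thesis using local[of k \<sigma> s] by (simp add: A_def E_def)
  qed
  ultimately show ?thesis by blast
qed

definition bounded_branches ::
  "(nat \<Rightarrow> (nat \<Rightarrow> nat) \<Rightarrow> 'w \<Rightarrow> 'a set) \<Rightarrow> (nat \<Rightarrow> nat) \<Rightarrow> 'w \<Rightarrow> 'a set" where
  "bounded_branches K m \<omega> = {\<xi>. \<exists>\<sigma>. (\<forall>i. \<sigma> i \<le> m i) \<and> (\<forall>k. \<xi> \<in> K k \<sigma> \<omega>)}"

definition bounded_branches_upto ::
  "(nat \<Rightarrow> (nat \<Rightarrow> nat) \<Rightarrow> 'w \<Rightarrow> 'a set) \<Rightarrow> (nat \<Rightarrow> nat) \<Rightarrow> nat \<Rightarrow> 'w \<Rightarrow> 'a set" where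
  "bounded_branches_upto K m n \<omega> = {\<xi>. \<exists>\<sigma>. (\<forall>i. \<sigma> i \<le> m i) \<and> (\<forall>k<n. \<xi> \<in> K k \<sigma> \<omega>)}"

lemma bounded_branches_upto_antimono:
  "n \<le> n' \<Longrightarrow> bounded_branches_upto K m n' \<omega> \<subseteq> bounded_branches_upto K m n \<omega>"
  unfolding bounded_branches_upto_def by (auto dest: less_le_trans)

lemma bounded_branches_eq_INT:
  assumes "souslin_scheme G K"
  shows "bounded_branches K m \<omega> = (\<Inter>n. bounded_branches_upto K m n \<omega>)"
proof -
  obtain N where N: "\<And>k \<sigma> \<tau>. \<forall>i<N k. \<sigma> i = \<tau> i \<Longrightarrow> K k \<sigma> = K k \<tau>"
    using assms by (rule souslin_scheme_local) blast
  have "\<xi> \<in> bounded_branches K m \<omega>" if "\<And>n. \<xi> \<in> bounded_branches_upto K m n \<omega>" for \<xi>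
  proof -
    have "\<exists>\<sigma>. (\<forall>i. \<sigma> i \<le> m i) \<and> (\<forall>k. \<xi> \<in> K k \<sigma> \<omega>)"
    proof (rule bounded_koenig)
      show "\<xi> \<in> K k \<tau> \<omega>" if "\<xi> \<in> K k \<sigma> \<omega>" "\<forall>i<N k. \<sigma> i = \<tau> i" for k \<sigma> \<tau>
        using that N by metis
    qed (use that in \<open>simp add: bounded_branches_upto_def\<close>)
    then show ?thesis by (simp add: bounded_branches_def)
  qed
  moreover have "bounded_branches K m \<omega> \<subseteq> bounded_branches_upto K m n \<omega>" for n
    unfolding bounded_branches_def bounded_branches_upto_def by auto
  ultimately show ?thesis by blast
qed

text \<open>
  The first \<open>n\<close> blocks see only finitely many terms of a bounded sequence, so that
  finitely many sequences have to be considered.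
\<close>

lemma simple_closed_bounded_branches_upto:
  assumes "souslin_scheme G K"
  shows "simple_closed G (bounded_branches_upto K m n)"
proof -
  have sc: "simple_closed G (K k \<sigma>)" for k \<sigma>
    using assms by (rule souslin_scheme_simple)
  obtain N where N: "\<And>k \<sigma> \<tau>. \<forall>i<N k. \<sigma> i = \<tau> i \<Longrightarrow> K k \<sigma> = K k \<tau>"
    using assms by (rule souslin_scheme_local) blast
  define b where "b = (\<Sum>k<n. N k)"
  have b: "N k \<le> b" if "k < n" for k
    unfolding b_def using that by (intro member_le_sum) auto
  have "bounded_branches_upto K m n \<omega> = (\<Union>\<sigma>\<in>(\<Pi>\<^sub>E i\<in>{..<b}. {..m i}). \<Inter>k\<in>{..<n}. K k \<sigma> \<omega>)" for \<omega>
  proof safe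
    fix \<xi> assume "\<xi> \<in> bounded_branches_upto K m n \<omega>"
    then obtain \<sigma> where \<sigma>: "\<forall>i. \<sigma> i \<le> m i" "\<forall>k<n. \<xi> \<in> K k \<sigma> \<omega>"
      unfolding bounded_branches_upto_def by blast
    have "K k (restrict \<sigma> {..<b}) = K k \<sigma>" if "k < n" for k
      by (rule N) (use b[OF that] in auto)
    then show "\<xi> \<in> (\<Union>\<sigma>\<in>(\<Pi>\<^sub>E i\<in>{..<b}. {..m i}). \<Inter>k\<in>{..<n}. K k \<sigma> \<omega>)"
      using \<sigma> by (intro UN_I[of "restrict \<sigma> {..<b}"]) auto
  next
    fix \<xi> \<sigma> assume \<sigma>: "\<sigma> \<in> (\<Pi>\<^sub>E i\<in>{..<b}. {..m i})" "\<xi> \<in> (\<Inter>k\<in>{..<n}. K k \<sigma> \<omega>)"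
    have "K k (\<lambda>i. if i < b then \<sigma> i else 0) = K k \<sigma>" if "k < n" for k
      by (rule N) (use b[OF that] in auto)
    moreover have "(if i < b then \<sigma> i else 0) \<le> m i" for i
      using \<sigma>(1) by (auto simp: PiE_iff)
    ultimately show "\<xi> \<in> bounded_branches_upto K m n \<omega>"
      unfolding bounded_branches_upto_def using \<sigma>(2)
      by (intro CollectI exI[of _ "\<lambda>i. if i < b then \<sigma> i else 0"]) auto
  qed
  then have "bounded_branches_upto K m n = (\<lambda>\<omega>. \<Union>\<sigma>\<in>(\<Pi>\<^sub>E i\<in>{..<b}. {..m i}). \<Inter>k\<in>{..<n}. K k \<sigma> \<omega>)"
    by blast
  then show ?thesis
    by (simp add: simple_closed_UN simple_closed_INT sc finite_PiE)
qed

lemma decseq_compact_INT_eq_empty: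
  fixes S :: "nat \<Rightarrow> 'a::heine_borel set"
  assumes "\<And>n. compact (S n)" "decseq S"
  shows "(\<Inter>n. S n) = {} \<longleftrightarrow> (\<exists>n. S n = {})"
  using compact_nest[of S] assms by (auto simp: decseq_def)

text \<open>
  Compactness in the sequence and compactness in the point together reduce a condition on infinite
  branches to conditions on finite ones, which are measurable in \<open>\<omega>\<close>.
\<close>

lemma bounded_branches_hit:
  fixes K :: "nat \<Rightarrow> (nat \<Rightarrow> nat) \<Rightarrow> 'w \<Rightarrow> 'a::heine_borel set"
  assumes "souslin_scheme G K" and cpt: "\<And>\<sigma> \<omega>. compact (K 0 \<sigma> \<omega>)" and "closed C"
  shows "bounded_branches K m \<omega> \<inter> C \<noteq> {} \<longleftrightarrow> (\<forall>n. bounded_branches_upto K m (Suc n) \<omega> \<inter> C \<noteq> {})"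
    and "compact (bounded_branches K m \<omega>)"
proof -
  let ?S = "\<lambda>n. bounded_branches_upto K m (Suc n) \<omega>"
  have dec: "decseq ?S"
    unfolding decseq_def by (simp add: bounded_branches_upto_antimono)
  have clo: "closed (?S n)" for n
    using simple_closed_closed[OF simple_closed_bounded_branches_upto[OF assms(1)]] .
  have "compact (?S 0)"
  proof -
    obtain N where N: "\<And>k \<sigma> \<tau>. \<forall>i<N k. \<sigma> i = \<tau> i \<Longrightarrow> K k \<sigma> = K k \<tau>"
      using assms(1) by (rule souslin_scheme_local) blast
    have "?S 0 \<subseteq> (\<Union>\<sigma>\<in>(\<Pi>\<^sub>E i\<in>{..<N 0}. {..m i}). K 0 \<sigma> \<omega>)"
    proof
      fix \<xi> assume "\<xi> \<in> ?S 0"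
      then obtain \<sigma> where \<sigma>: "\<forall>i. \<sigma> i \<le> m i" "\<xi> \<in> K 0 \<sigma> \<omega>"
        unfolding bounded_branches_upto_def by blast
      have "K 0 (restrict \<sigma> {..<N 0}) = K 0 \<sigma>" by (rule N) auto
      then show "\<xi> \<in> (\<Union>\<sigma>\<in>(\<Pi>\<^sub>E i\<in>{..<N 0}. {..m i}). K 0 \<sigma> \<omega>)"
        using \<sigma> by (intro UN_I[of "restrict \<sigma> {..<N 0}"]) auto
    qed
    moreover have "compact (\<Union>\<sigma>\<in>(\<Pi>\<^sub>E i\<in>{..<N 0}. {..m i}). K 0 \<sigma> \<omega>)"
      by (intro compact_UN finite_PiE) (auto simp: cpt)
    ultimately show ?thesis using clo[of 0] by (metis compact_Int_closed inf.absorb_iff2)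
  qed
  then have c: "compact (?S n)" for n
    using clo[of n] dec by (metis compact_Int_closed decseqD inf.absorb_iff2 le0)
  have eq: "bounded_branches K m \<omega> = (\<Inter>n. ?S n)"
  proof -
    have "(\<Inter>n. bounded_branches_upto K m n \<omega>) = (\<Inter>n. ?S n)"
      by (rule antisym) (use bounded_branches_upto_antimono[OF le_SucI[OF order_refl], of K m _ \<omega>] in blast)+
    then show ?thesis using bounded_branches_eq_INT[OF assms(1)] by metis
  qed
  show "compact (bounded_branches K m \<omega>)"
    unfolding eq using c clo by (intro compact_Inter) auto
  have "(\<Inter>n. ?S n \<inter> C) = {} \<longleftrightarrow> (\<exists>n. ?S n \<inter> C = {})"
    using c \<open>closed C\<close> dec by (intro decseq_compact_INT_eq_empty) (auto simp: decseq_def compact_Int_closed)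
  moreover have "(\<Inter>n. ?S n \<inter> C) = bounded_branches K m \<omega> \<inter> C" unfolding eq by auto
  ultimately show "bounded_branches K m \<omega> \<inter> C \<noteq> {} \<longleftrightarrow> (\<forall>n. ?S n \<inter> C \<noteq> {})" by auto
qed

lemma sets_bounded_branches_hit:
  fixes K :: "nat \<Rightarrow> (nat \<Rightarrow> nat) \<Rightarrow> 'w \<Rightarrow> 'a::heine_borel set"
  assumes "souslin_scheme G K" and "\<And>\<sigma> \<omega>. compact (K 0 \<sigma> \<omega>)" and "closed C"
  shows "{\<omega> \<in> space G. bounded_branches K m \<omega> \<inter> C \<noteq> {}} \<in> sets G"
proof -
  have "{\<omega> \<in> space G. bounded_branches K m \<omega> \<inter> C \<noteq> {}} =
      (\<Inter>n. {\<omega> \<in> space G. bounded_branches_upto K m (Suc n) \<omega> \<inter> C \<noteq> {}})"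
    using bounded_branches_hit(1)[OF assms] by auto
  also have "\<dots> \<in> sets G"
    using simple_closed_hit[OF simple_closed_bounded_branches_upto[OF assms(1)]]
    by (intro sets.countable_INT) auto
  finally show ?thesis .
qed

text \<open>
  Choquet's capacitability argument. The outer measure of the projection is continuous along
  increasing unions, hence one may bound the terms of the sequence one after another and always
  keep outer measure above \<open>t\<close>. In the limit all terms are bounded; continuity of the
  measure along the decreasing sequence of measurable finite-stage projections shows that the
  compact part that remains still projects to a set of measure at least \<open>t\<close>.
\<close>

lemma souslin_capacity:
  fixes K :: "nat \<Rightarrow> (nat \<Rightarrow> nat) \<Rightarrow> 'w \<Rightarrow> 'a::heine_borel set"
  assumes fin: "finite_measure M" and sub: "subalgebra M G"
    and K: "souslin_scheme G K" and cpt: "\<And>\<sigma> \<omega>. compact (K 0 \<sigma> \<omega>)"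
    and ae: "AE \<omega> in M. \<exists>\<xi> \<sigma>. \<forall>k. \<xi> \<in> K k \<sigma> \<omega>"
    and t: "t < emeasure M (space M)"
  obtains m where "t \<le> emeasure M {\<omega> \<in> space M. bounded_branches K m \<omega> \<noteq> {}}"
proof -
  interpret finite_measure M by (rule fin)
  obtain N where N: "\<And>k \<sigma> \<tau>. \<forall>i<N k. \<sigma> i = \<tau> i \<Longrightarrow> K k \<sigma> = K k \<tau>"
    using K by (rule souslin_scheme_local) blast
  define S where "S n m = {\<omega> \<in> space M. \<exists>\<sigma> \<xi>. (\<forall>i<n. \<sigma> i \<le> m i) \<and> (\<forall>k. \<xi> \<in> K k \<sigma> \<omega>)}"
    for n and m :: "nat \<Rightarrow> nat"
  obtain m where m: "\<And>n. t < outer_measure_of M (S n m)"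
  proof (rule prefix_choice[of "\<lambda>n m. t < outer_measure_of M (S n m)"])
    \<comment> \<open>Without any bound the projection has full outer measure, since it contains almost every point.\<close>
    have "emeasure M (space M) \<le> outer_measure_of M (S 0 (\<lambda>_. 0))"
      unfolding outer_measure_of_def
    proof (rule INF_greatest, clarify)
      fix E assume E: "E \<in> sets M" "S 0 (\<lambda>_. 0) \<subseteq> E"
      have "AE \<omega> in M. \<omega> \<in> space M \<longleftrightarrow> \<omega> \<in> E"
        using ae AE_space by eventually_elim (use E(2) in \<open>auto simp: S_def\<close>)
      then show "emeasure M (space M) \<le> emeasure M E"
        using emeasure_eq_AE[of "space M" E M] E(1) by simp
    qed
    then show "t < outer_measure_of M (S 0 (\<lambda>_. 0))" using t by order
  next
    fix n m assume *: "t < outer_measure_of M (S n m)"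
    have S_Suc: "S (Suc n) (m(n := v)) =
        {\<omega> \<in> space M. \<exists>\<sigma> \<xi>. ((\<forall>i<n. \<sigma> i \<le> m i) \<and> \<sigma> n \<le> v) \<and> (\<forall>k. \<xi> \<in> K k \<sigma> \<omega>)}" for v
    proof -
      have "(\<forall>i<Suc n. \<sigma> i \<le> (m(n := v)) i) \<longleftrightarrow> (\<forall>i<n. \<sigma> i \<le> m i) \<and> \<sigma> n \<le> v" for \<sigma>
        by (auto simp: less_Suc_eq)
      then show ?thesis by (simp only: S_def)
    qed
    have "(SUP v. outer_measure_of M (S (Suc n) (m(n := v)))) = outer_measure_of M (\<Union>v. S (Suc n) (m(n := v)))"
    proof (rule SUP_outer_measure_of_incseq)
      show "incseq (\<lambda>v. S (Suc n) (m(n := v)))"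
        unfolding incseq_def S_Suc by (blast intro: order_trans)
    qed (auto simp: S_def)
    also have "(\<Union>v. S (Suc n) (m(n := v))) = S n m"
      unfolding S_Suc by (auto simp: S_def)
    finally have "t < (SUP v. outer_measure_of M (S (Suc n) (m(n := v))))"
      using * by metis
    then show "\<exists>v. t < outer_measure_of M (S (Suc n) (m(n := v)))"
      unfolding less_SUP_iff by blast
  next
    fix n m m' assume "t < outer_measure_of M (S n m)" "\<And>i. i < n \<Longrightarrow> m i = m' i"
    moreover from this have "S n m = S n m'" unfolding S_def by auto
    ultimately show "t < outer_measure_of M (S n m')" by simp
  qed blast
  let ?A = "\<lambda>n. {\<omega> \<in> space M. bounded_branches_upto K m (Suc n) \<omega> \<noteq> {}}"
  have A: "?A n \<in> sets M" for n
    using simple_closed_hit[OF simple_closed_bounded_branches_upto[OF K], of m "Suc n" UNIV] sub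
    by (auto simp: subalgebra_def)
  have dec: "decseq ?A"
  proof (rule decseq_SucI)
    show "?A (Suc n) \<subseteq> ?A n" for n
      using bounded_branches_upto_antimono[of "Suc n" "Suc (Suc n)" K m] by auto
  qed
  have le: "t \<le> emeasure M (?A n)" for n
  proof -
    define b where "b = (\<Sum>k<Suc n. N k)"
    have b: "N k \<le> b" if "k < Suc n" for k
      unfolding b_def using that by (intro member_le_sum) auto
    have "S b m \<subseteq> ?A n"
    proof
      fix \<omega> assume "\<omega> \<in> S b m"
      then obtain \<sigma> \<xi> where \<sigma>: "\<omega> \<in> space M" "\<forall>i<b. \<sigma> i \<le> m i" "\<forall>k. \<xi> \<in> K k \<sigma> \<omega>"
        unfolding S_def by blast
      have "K k (\<lambda>i. if i < b then \<sigma> i else 0) = K k \<sigma>" if "k < Suc n" for k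
        by (rule N) (use b[OF that] in auto)
      then have "\<xi> \<in> bounded_branches_upto K m (Suc n) \<omega>"
        unfolding bounded_branches_upto_def using \<sigma>
        by (intro CollectI exI[of _ "\<lambda>i. if i < b then \<sigma> i else 0"]) auto
      then show "\<omega> \<in> ?A n" using \<sigma>(1) by blast
    qed
    then have "outer_measure_of M (S b m) \<le> emeasure M (?A n)"
      using outer_measure_of_mono[of "S b m" "?A n" M] A[of n] by simp
    then show ?thesis using m[of b] by order
  qed
  have eq: "{\<omega> \<in> space M. bounded_branches K m \<omega> \<noteq> {}} = (\<Inter>n. ?A n)"
    using bounded_branches_hit(1)[OF K cpt closed_UNIV] by auto
  have "t \<le> emeasure M (\<Inter>n. ?A n)"
  proof -
    have "(INF n. emeasure M (?A n)) = emeasure M (\<Inter>n. ?A n)"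
      using A dec by (intro INF_emeasure_decseq) auto
    then show ?thesis using le by (metis (no_types, lifting) INF_greatest)
  qed
  then show ?thesis by (intro that[of m]) (simp only: eq)
qed

section \<open>Measurable selections\<close>

text \<open>
  Run through the complements of the sets of a countable base and intersect the current set with
  each complement that it meets. Two different points are separated by such a complement, so only
  one point survives; by compactness this point lies in a closed set precisely if all the sets
  produced on the way meet it, and these conditions are measurable.
\<close>

lemma compact_measurable_selection:
  fixes S :: "'w \<Rightarrow> 'a::euclidean_space set"
  assumes cpt: "\<And>\<omega>. \<omega> \<in> space G \<Longrightarrow> compact (S \<omega>)"
    and hit: "\<And>C. closed C \<Longrightarrow> {\<omega> \<in> space G. S \<omega> \<inter> C \<noteq> {}} \<in> sets G"
  obtains u where "u \<in> borel_measurable G"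
    and "\<And>\<omega>. \<omega> \<in> space G \<Longrightarrow> S \<omega> \<noteq> {} \<Longrightarrow> u \<omega> \<in> S \<omega>"
proof -
  obtain \<B> :: "nat \<Rightarrow> 'a set" where op: "\<And>i. open (\<B> i)"
    and sep: "\<And>x y. x \<noteq> y \<Longrightarrow> \<exists>i. y \<in> \<B> i \<and> x \<notin> \<B> i"
  proof -
    obtain B :: "'a set set" where B: "countable B" "\<And>b. b \<in> B \<Longrightarrow> open b"
      "\<And>S. open S \<Longrightarrow> \<exists>U. U \<subseteq> B \<and> S = \<Union>U"
      using univ_second_countable by metis
    have ne: "B \<noteq> {}" using B(3)[of UNIV] by auto
    show ?thesis
    proof (rule that[of "from_nat_into B"])
      show "open (from_nat_into B i)" for i
        using B(2) from_nat_into[OF ne] by blast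
      fix x y :: 'a assume "x \<noteq> y"
      obtain U where "U \<subseteq> B" "- {x} = \<Union>U" using B(3)[of "- {x}"] by auto
      then obtain b where "b \<in> B" "y \<in> b" "x \<notin> b" using \<open>x \<noteq> y\<close> by blast
      then show "\<exists>i. y \<in> from_nat_into B i \<and> x \<notin> from_nat_into B i"
        using from_nat_into_surj[OF B(1)] by metis
    qed
  qed
  define R where "R = rec_nat S (\<lambda>i R \<omega>. if R \<omega> - \<B> i = {} then R \<omega> else R \<omega> - \<B> i)"
  have R0: "R 0 = S" and RS: "R (Suc i) = (\<lambda>\<omega>. if R i \<omega> - \<B> i = {} then R i \<omega> else R i \<omega> - \<B> i)" for i
    unfolding R_def by (rule old.nat.rec)+
  have Rc: "compact (R i \<omega>)" if "\<omega> \<in> space G" for i \<omega>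
    by (induction i) (auto simp: R0 RS cpt that op compact_diff)
  have Rne: "R i \<omega> \<noteq> {}" if "S \<omega> \<noteq> {}" for i \<omega>
    by (induction i) (use that in \<open>auto simp: R0 RS\<close>)
  have Rdec: "decseq (\<lambda>i. R i \<omega>)" for \<omega>
    by (rule decseq_SucI) (auto simp: RS)
  have Rhit: "{\<omega> \<in> space G. R i \<omega> \<inter> C \<noteq> {}} \<in> sets G" if "closed C" for i C
    using that
  proof (induction i arbitrary: C)
    case (Suc i)
    let ?H = "\<lambda>C. {\<omega> \<in> space G. R i \<omega> \<inter> C \<noteq> {}}"
    have "{\<omega> \<in> space G. R (Suc i) \<omega> \<inter> C \<noteq> {}} = ?H (C \<inter> - \<B> i) \<union> (?H C - ?H (- \<B> i))"
      by (auto simp: RS)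
    moreover have "?H (C \<inter> - \<B> i) \<in> sets G" "?H C \<in> sets G" "?H (- \<B> i) \<in> sets G"
      using Suc.prems op by (intro Suc.IH; simp add: closed_Int closed_Compl)+
    ultimately show ?case by simp
  qed (simp add: R0 hit)
  have single: "\<exists>x. (\<Inter>i. R i \<omega>) = {x}" if "\<omega> \<in> space G" "S \<omega> \<noteq> {}" for \<omega>
  proof -
    have "(\<Inter>i. R i \<omega>) \<noteq> {}"
      using decseq_compact_INT_eq_empty[of "\<lambda>i. R i \<omega>"] Rc[OF that(1)] Rne[OF that(2)] Rdec by blast
    moreover have "x = y" if xy: "x \<in> (\<Inter>i. R i \<omega>)" "y \<in> (\<Inter>i. R i \<omega>)" for x y
    proof (rule ccontr)
      assume "x \<noteq> y"
      then obtain i where i: "y \<in> \<B> i" "x \<notin> \<B> i" using sep by blast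
      have "x \<in> R i \<omega>" "y \<in> R (Suc i) \<omega>" using xy by blast+
      then show False using i by (auto simp: RS split: if_splits)
    qed
    ultimately show ?thesis by blast
  qed
  define u where "u \<omega> = (if S \<omega> = {} then 0 else the_elem (\<Inter>i. R i \<omega>))" for \<omega>
  have u: "(\<Inter>i. R i \<omega>) = {u \<omega>}" if \<omega>: "\<omega> \<in> space G" "S \<omega> \<noteq> {}" for \<omega>
  proof -
    obtain x where "(\<Inter>i. R i \<omega>) = {x}" using single[OF \<omega>] by blast
    then show ?thesis using \<omega> by (simp add: u_def)
  qed
  show ?thesis
  proof (rule that)
    show "u \<omega> \<in> S \<omega>" if "\<omega> \<in> space G" "S \<omega> \<noteq> {}" for \<omega>
      using u[OF that] R0 by blast
    have "u -` C \<inter> space G \<in> sets G" if C: "closed C" for C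
    proof -
      have *: "u \<omega> \<in> C \<longleftrightarrow> (\<forall>i. R i \<omega> \<inter> C \<noteq> {})" if \<omega>: "\<omega> \<in> space G" "S \<omega> \<noteq> {}" for \<omega>
      proof -
        have "(\<Inter>i. R i \<omega> \<inter> C) = {} \<longleftrightarrow> (\<exists>i. R i \<omega> \<inter> C = {})"
          using Rc[OF \<omega>(1)] C Rdec[of \<omega>]
          by (intro decseq_compact_INT_eq_empty) (auto simp: decseq_def compact_Int_closed)
        moreover have "(\<Inter>i. R i \<omega> \<inter> C) = {u \<omega>} \<inter> C"
          using u[OF \<omega>] by blast
        ultimately show ?thesis by auto
      qed
      have "u -` C \<inter> space G = (\<Inter>i. {\<omega> \<in> space G. R i \<omega> \<inter> C \<noteq> {}}) \<union>
          (if 0 \<in> C then space G - {\<omega> \<in> space G. S \<omega> \<inter> UNIV \<noteq> {}} else {})" (is "?L = ?R")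
      proof (rule set_eqI)
        fix \<omega>
        show "\<omega> \<in> ?L \<longleftrightarrow> \<omega> \<in> ?R"
        proof (cases "S \<omega> = {}")
          case True
          then have "R 0 \<omega> \<inter> C = {}" using R0 by simp
          then have "\<not> (\<forall>i. R i \<omega> \<inter> C \<noteq> {})" by blast
          with True show ?thesis by (auto simp: u_def)
        next
          case False
          then show ?thesis using * by auto
        qed
      qed
      also have "\<dots> \<in> sets G"
        using Rhit[OF C] hit[OF closed_UNIV] by (intro sets.Un sets.countable_INT) auto
      finally show ?thesis .
    qed
    then show "u \<in> borel_measurable G"
      unfolding borel_eq_closed by (intro measurable_measure_of) auto
  qed
qed

text \<open>
  The von Neumann-Aumann selection theorem for a possibly incomplete \<sigma>-algebra: the
  projection of \<open>B\<close> may be non-measurable, but the capacity argument yields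
  measurable sets \<open>A n\<close> in \<open>G\<close> that exhaust the space up to a null set
  and carry exact selections, which are then glued. The capacity is the outer measure of
  \<open>M\<close> and not that of its restriction to \<open>G\<close>, because the exceptional
  set in the hypothesis is null for \<open>M\<close> but may fail to be covered by a null set in
  \<open>G\<close>.
\<close>

theorem measurable_selection:
  fixes B :: "('w \<times> 'a::euclidean_space) set"
  assumes fin: "finite_measure M" and sub: "subalgebra M G"
    and B: "B \<in> sets (G \<Otimes>\<^sub>M borel)"
    and ae: "AE \<omega> in M. \<exists>\<xi>. (\<omega>, \<xi>) \<in> B"
  obtains u where "u \<in> borel_measurable G" "AE \<omega> in M. (\<omega>, u \<omega>) \<in> B"
proof -
  interpret finite_measure M by (rule fin)
  have sp: "space G = space M" and setsG: "A \<in> sets G \<Longrightarrow> A \<in> sets M" for A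
    using sub by (auto simp: subalgebra_def)
  obtain K where K: "souslin_scheme G K"
    and BK: "\<And>\<omega> \<xi>. \<omega> \<in> space G \<Longrightarrow> (\<omega>, \<xi>) \<in> B \<longleftrightarrow> (\<exists>\<sigma>. \<forall>k. \<xi> \<in> K k \<sigma> \<omega>)"
    using souslin_if_pair_measurable[OF B] unfolding souslin_def by blast
  \<comment> \<open>An additional first term bounds the points, so that all blocks become compact.\<close>
  define K' where "K' k \<sigma> \<omega> = K k (\<lambda>i. \<sigma> (Suc i)) \<omega> \<inter> cball 0 (real (\<sigma> 0))" for k \<sigma> \<omega>
  have K': "souslin_scheme G K'"
  proof -
    obtain N where N: "\<And>k \<sigma> \<tau>. \<forall>i<N k. \<sigma> i = \<tau> i \<Longrightarrow> K k \<sigma> = K k \<tau>"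
      using K by (rule souslin_scheme_local) blast
    show ?thesis
    proof (rule souslin_schemeI)
      show "simple_closed G (K' k \<sigma>)" for k \<sigma>
        using simple_closed_combine[OF souslin_scheme_simple[OF K] simple_closed_const[OF closed_cball], of "(\<inter>)"]
        by (simp add: K'_def[abs_def] closed_Int)
      fix k and \<sigma> \<tau> :: "nat \<Rightarrow> nat" assume "\<And>i. i < Suc (N k) \<Longrightarrow> \<sigma> i = \<tau> i"
      then have "\<sigma> 0 = \<tau> 0" "K k (\<lambda>i. \<sigma> (Suc i)) = K k (\<lambda>i. \<tau> (Suc i))"
        by (auto intro!: N)
      then show "K' k \<sigma> = K' k \<tau>" by (simp add: K'_def[abs_def])
    qed
  qed
  have BK': "(\<omega>, \<xi>) \<in> B \<longleftrightarrow> (\<exists>\<sigma>. \<forall>k. \<xi> \<in> K' k \<sigma> \<omega>)" if \<omega>: "\<omega> \<in> space G" for \<omega> \<xi>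
  proof
    assume "(\<omega>, \<xi>) \<in> B"
    then obtain \<sigma> where "\<forall>k. \<xi> \<in> K k \<sigma> \<omega>" using BK[OF \<omega>] by blast
    moreover obtain n :: nat where "norm \<xi> \<le> real n" using real_arch_simple by blast
    ultimately have "\<forall>k. \<xi> \<in> K' k (case_nat n \<sigma>) \<omega>" by (simp add: K'_def)
    then show "\<exists>\<sigma>. \<forall>k. \<xi> \<in> K' k \<sigma> \<omega>" by blast
  next
    assume "\<exists>\<sigma>. \<forall>k. \<xi> \<in> K' k \<sigma> \<omega>"
    then show "(\<omega>, \<xi>) \<in> B" unfolding BK[OF \<omega>] K'_def by blast
  qed
  have cpt: "compact (K' 0 \<sigma> \<omega>)" for \<sigma> \<omega>
    unfolding K'_def
    using simple_closed_closed[OF souslin_scheme_simple[OF K]] by (intro closed_Int_compact) auto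
  define c where "c = measure M (space M)"
  have "\<exists>A U. A \<in> sets G \<and> U \<in> borel_measurable G \<and> (\<forall>\<omega>\<in>A. (\<omega>, U \<omega>) \<in> B) \<and>
      c - 1 / real (Suc n) \<le> measure M A" for n
  proof (cases "c - 1 / real (Suc n) < 0")
    case True
    then show ?thesis by (intro exI[of _ "{}"] exI[of _ "\<lambda>_. 0"]) auto
  next
    case False
    then have less: "ennreal (c - 1 / real (Suc n)) < emeasure M (space M)"
      unfolding emeasure_eq_measure c_def by (subst ennreal_less_iff) auto
    have ae': "AE \<omega> in M. \<exists>\<xi> \<sigma>. \<forall>k. \<xi> \<in> K' k \<sigma> \<omega>"
      using ae AE_space by eventually_elim (use BK' sp in metis)
    obtain m where m: "ennreal (c - 1 / real (Suc n)) \<le> emeasure M {\<omega> \<in> space M. bounded_branches K' m \<omega> \<noteq> {}}"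
      using souslin_capacity[OF fin sub K' cpt ae' less] by blast
    obtain U where U: "U \<in> borel_measurable G"
      "\<And>\<omega>. \<omega> \<in> space G \<Longrightarrow> bounded_branches K' m \<omega> \<noteq> {} \<Longrightarrow> U \<omega> \<in> bounded_branches K' m \<omega>"
      using compact_measurable_selection[of G "bounded_branches K' m"]
        bounded_branches_hit(2)[OF K' cpt closed_UNIV] sets_bounded_branches_hit[OF K' cpt] by blast
    show ?thesis
    proof (intro exI conjI ballI)
      show "{\<omega> \<in> space M. bounded_branches K' m \<omega> \<noteq> {}} \<in> sets G"
        using sets_bounded_branches_hit[OF K' cpt closed_UNIV] sp by simp
      show "U \<in> borel_measurable G" by (rule U)
      show "(\<omega>, U \<omega>) \<in> B" if "\<omega> \<in> {\<omega> \<in> space M. bounded_branches K' m \<omega> \<noteq> {}}" for \<omega>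
        using that U(2)[of \<omega>] BK'[of \<omega>] sp unfolding bounded_branches_def by auto
      show "c - 1 / real (Suc n) \<le> measure M {\<omega> \<in> space M. bounded_branches K' m \<omega> \<noteq> {}}"
        using m unfolding emeasure_eq_measure by (simp add: ennreal_le_iff)
    qed
  qed
  then obtain A U where A: "\<And>n. A n \<in> sets G" and U: "\<And>n. U n \<in> borel_measurable G"
    and AU: "\<And>n \<omega>. \<omega> \<in> A n \<Longrightarrow> (\<omega>, U n \<omega>) \<in> B"
    and large: "\<And>n. c - 1 / real (Suc n) \<le> measure M (A n)"
    by metis
  show ?thesis
  proof (rule that)
    have "(\<lambda>\<omega>. LEAST n. \<omega> \<in> A n) \<in> measurable G (count_space UNIV)"
      using A by measurable
    then show "(\<lambda>\<omega>. U (LEAST n. \<omega> \<in> A n) \<omega>) \<in> borel_measurable G"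
      by (rule measurable_compose_countable[of U G borel, OF U])
    have UA: "(\<Union>n. A n) \<in> sets M" using A setsG by auto
    have approx: "c \<le> measure M (\<Union>n. A n) + 1 / real (Suc n)" for n
      using large[of n] finite_measure_mono[OF _ UA, of "A n"] by fastforce
    have "c \<le> measure M (\<Union>n. A n)"
    proof (rule ccontr)
      assume "\<not> c \<le> measure M (\<Union>n. A n)"
      then obtain n where "1 / real (Suc n) < c - measure M (\<Union>n. A n)"
        using nat_approx_posE[of "c - measure M (\<Union>n. A n)"] by auto
      then show False using approx[of n] by linarith
    qed
    then have "measure M (space M - (\<Union>n. A n)) = 0"
      using finite_measure_compl[OF UA] bounded_measure[of "\<Union>n. A n"] by (simp add: c_def)
    then have "space M - (\<Union>n. A n) \<in> null_sets M"
      using UA by (simp add: null_sets_def emeasure_eq_measure)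
    from AE_not_in[OF this] AE_space show "AE \<omega> in M. (\<omega>, U (LEAST n. \<omega> \<in> A n) \<omega>) \<in> B"
    proof eventually_elim
      case (elim \<omega>)
      then obtain n where "\<omega> \<in> A n" by blast
      then have "\<omega> \<in> A (LEAST n. \<omega> \<in> A n)" by (rule LeastI)
      then show ?case by (rule AU)
    qed
  qed
qed

section \<open>Measurable closed-valued multifunctions\<close>

text \<open>
  A point of the set within distance \<open>r\<close> is witnessed by a small ball with centre in
  a countable dense set and rational radius, so the hitting sets of balls suffice. Where the set
  is empty, the distance is \<open>0\<close> by convention.
\<close>

lemma borel_measurable_infdist_multifunction:
  fixes S :: "'w \<Rightarrow> 'a::euclidean_space set"
  assumes S: "measurable_multifunction G S" and v[measurable]: "v \<in> borel_measurable G"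
  shows "(\<lambda>\<omega>. infdist (v \<omega>) (S \<omega>)) \<in> borel_measurable G"
proof (subst borel_measurable_iff_less, rule allI)
  fix r :: real
  obtain D :: "'a set" where D: "countable D" "\<And>U. open U \<Longrightarrow> U \<noteq> {} \<Longrightarrow> \<exists>d\<in>D. d \<in> U"
    using countable_dense_exists by blast
  have hit: "{\<omega> \<in> space G. S \<omega> \<inter> U \<noteq> {}} \<in> sets G" if "open U" for U
    using S that by (auto simp: measurable_multifunction_def)
  have "infdist (v \<omega>) (S \<omega>) < r \<longleftrightarrow>
      (\<exists>q\<in>D. \<exists>s\<in>\<rat>. S \<omega> \<inter> ball q s \<noteq> {} \<and> dist (v \<omega>) q + s < r)" if ne: "S \<omega> \<noteq> {}" for \<omega>
  proof
    assume "infdist (v \<omega>) (S \<omega>) < r"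
    then obtain y where y: "y \<in> S \<omega>" "dist (v \<omega>) y < r"
      using ne by (auto simp: infdist_notempty cINF_less_iff)
    define e where "e = (r - dist (v \<omega>) y) / 2"
    have "e > 0" using y by (simp add: e_def)
    then obtain q where q: "q \<in> D" "dist y q < e"
      using D(2)[of "ball y e"] by auto
    obtain s where s: "s \<in> \<rat>" "dist y q < s" "s < e"
      using Rats_dense_in_real[OF q(2)] by blast
    have "dist (v \<omega>) q + s < r"
      using dist_triangle[of "v \<omega>" q y] q(2) s(3) by (simp add: e_def field_simps)
    moreover have "y \<in> S \<omega> \<inter> ball q s" using y s by (simp add: dist_commute)
    ultimately show "\<exists>q\<in>D. \<exists>s\<in>\<rat>. S \<omega> \<inter> ball q s \<noteq> {} \<and> dist (v \<omega>) q + s < r"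
      using q(1) s(1) by blast
  next
    assume "\<exists>q\<in>D. \<exists>s\<in>\<rat>. S \<omega> \<inter> ball q s \<noteq> {} \<and> dist (v \<omega>) q + s < r"
    then obtain q s y where y: "y \<in> S \<omega>" "dist q y < s" "dist (v \<omega>) q + s < r"
      by auto
    then show "infdist (v \<omega>) (S \<omega>) < r"
      using infdist_le[OF y(1), of "v \<omega>"] dist_triangle[of "v \<omega>" y q] by linarith
  qed
  then have *: "infdist (v \<omega>) (S \<omega>) < r \<longleftrightarrow> (if S \<omega> = {} then 0 < r else
      (\<exists>q\<in>D. \<exists>s\<in>\<rat>. S \<omega> \<inter> ball q s \<noteq> {} \<and> dist (v \<omega>) q + s < r))" for \<omega>
    by (simp add: infdist_def)
  have "{\<omega> \<in> space G. infdist (v \<omega>) (S \<omega>) < r} =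
      (if 0 < r then space G - {\<omega> \<in> space G. S \<omega> \<inter> UNIV \<noteq> {}} else {}) \<union>
      (\<Union>q\<in>D. \<Union>s\<in>\<rat>. {\<omega> \<in> space G. S \<omega> \<inter> ball q s \<noteq> {}} \<inter> {\<omega> \<in> space G. dist (v \<omega>) q + s < r})"
    (is "_ = ?R")
    unfolding * by (auto split: if_splits)
  also have "?R \<in> sets G"
  proof (rule sets.Un)
    show "(\<Union>q\<in>D. \<Union>s\<in>\<rat>. {\<omega> \<in> space G. S \<omega> \<inter> ball q s \<noteq> {}} \<inter>
        {\<omega> \<in> space G. dist (v \<omega>) q + s < r}) \<in> sets G"
      by (intro sets.countable_UN''[OF D(1)] sets.countable_UN''[OF countable_rat] sets.Int hit open_ball)
        measurable
  qed (use hit[OF open_UNIV] in auto)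
  finally show "{\<omega> \<in> space G. infdist (v \<omega>) (S \<omega>) < r} \<in> sets G" .
qed

lemma sets_in_closed_multifunction:
  fixes S :: "'w \<Rightarrow> 'a::euclidean_space set"
  assumes S: "measurable_multifunction G S" and cl: "\<And>\<omega>. \<omega> \<in> space G \<Longrightarrow> closed (S \<omega>)"
    and v: "v \<in> borel_measurable G"
  shows "{\<omega> \<in> space G. v \<omega> \<in> S \<omega>} \<in> sets G"
proof -
  have "{\<omega> \<in> space G. v \<omega> \<in> S \<omega>} =
      {\<omega> \<in> space G. S \<omega> \<inter> UNIV \<noteq> {}} \<inter> {\<omega> \<in> space G. infdist (v \<omega>) (S \<omega>) = 0}"
    using in_closed_iff_infdist_zero[OF cl] by auto
  moreover have "{\<omega> \<in> space G. S \<omega> \<inter> UNIV \<noteq> {}} \<in> sets G"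
    using S open_UNIV unfolding measurable_multifunction_def by blast
  moreover have "{\<omega> \<in> space G. infdist (v \<omega>) (S \<omega>) = 0} \<in> sets G"
    using borel_measurable_infdist_multifunction[OF S v] by measurable
  ultimately show ?thesis by simp
qed

lemma measurable_multifunction_fst:
  assumes "measurable_multifunction G S"
  shows "measurable_multifunction (G \<Otimes>\<^sub>M H) (\<lambda>z. S (fst z))"
  unfolding measurable_multifunction_def
proof safe
  fix U :: "'b set" assume "open U"
  then have "{\<omega> \<in> space G. S \<omega> \<inter> U \<noteq> {}} \<times> space H \<in> sets (G \<Otimes>\<^sub>M H)"
    using assms by (auto simp: measurable_multifunction_def)
  moreover have "{z \<in> space (G \<Otimes>\<^sub>M H). S (fst z) \<inter> U \<noteq> {}} = {\<omega> \<in> space G. S \<omega> \<inter> U \<noteq> {}} \<times> space H"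
    by (auto simp: space_pair_measure)
  ultimately show "{z \<in> space (G \<Otimes>\<^sub>M H). S (fst z) \<inter> U \<noteq> {}} \<in> sets (G \<Otimes>\<^sub>M H)" by simp
qed

section \<open>Estimates in the Lebesgue spaces\<close>

text \<open>
  This crude inequality serves for the exponents \<open>p\<close> and \<open>1 / p\<close>. It
  makes the \<open>L\<^sub>p\<close>-norm satisfy a triangle inequality up to a factor, which is
  as good as Minkowski's inequality for subregularity, where only the existence of a constant
  matters.
\<close>

lemma powr_add3_le:
  fixes a b c q :: real
  assumes "a \<ge> 0" "b \<ge> 0" "c \<ge> 0" "q \<ge> 0"
  shows "(a + b + c) powr q \<le> 3 powr q * (a powr q + b powr q + c powr q)"
proof -
  define d where "d = max a (max b c)"
  have "(a + b + c) powr q \<le> (3 * d) powr q"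
    using assms by (intro powr_mono2) (auto simp: d_def)
  also have "\<dots> = 3 powr q * d powr q"
    using assms by (intro powr_mult)
  also have "d powr q \<le> a powr q + b powr q + c powr q"
    by (auto simp: d_def max_def)
  finally show ?thesis by simp
qed

lemma Lp_norm_nonneg [simp]: "Lp_norm M p x \<ge> 0"
  unfolding Lp_norm_def by simp

lemma Lp_dominated:
  fixes v :: "'w \<Rightarrow> 'a::euclidean_space" and a :: "'w \<Rightarrow> 'b::euclidean_space"
    and b :: "'w \<Rightarrow> 'c::euclidean_space" and c :: "'w \<Rightarrow> 'd::euclidean_space"
  assumes p: "p \<ge> 1" and C: "C \<ge> 0" and v[measurable]: "v \<in> borel_measurable M"
    and a: "integrable M (\<lambda>\<omega>. norm (a \<omega>) powr p)"
    and b: "integrable M (\<lambda>\<omega>. norm (b \<omega>) powr p)"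
    and c: "integrable M (\<lambda>\<omega>. norm (c \<omega>) powr p)"
    and le: "AE \<omega> in M. norm (v \<omega>) \<le> C * (norm (a \<omega>) + norm (b \<omega>) + norm (c \<omega>))"
  shows "integrable M (\<lambda>\<omega>. norm (v \<omega>) powr p)"
    and "Lp_norm M p v \<le> 9 * C * (Lp_norm M p a + Lp_norm M p b + Lp_norm M p c)"
proof -
  let ?g = "\<lambda>\<omega>. (3 * C) powr p * (norm (a \<omega>) powr p + norm (b \<omega>) powr p + norm (c \<omega>) powr p)"
  let ?I = "\<lambda>w::'w \<Rightarrow> real. \<integral>\<omega>. w \<omega> powr p \<partial>M"
  have g: "integrable M ?g"
    using a b c by (intro integrable_mult_right Bochner_Integration.integrable_add)
  have ae: "AE \<omega> in M. norm (v \<omega>) powr p \<le> ?g \<omega>"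
    using le
  proof eventually_elim
    case (elim \<omega>)
    have "norm (v \<omega>) powr p \<le> (C * (norm (a \<omega>) + norm (b \<omega>) + norm (c \<omega>))) powr p"
      using elim p by (intro powr_mono2) auto
    also have "\<dots> = C powr p * (norm (a \<omega>) + norm (b \<omega>) + norm (c \<omega>)) powr p"
      using C by (intro powr_mult)
    also have "\<dots> \<le> C powr p * (3 powr p * (norm (a \<omega>) powr p + norm (b \<omega>) powr p + norm (c \<omega>) powr p))"
      using p by (intro mult_left_mono powr_add3_le) auto
    also have "\<dots> = ?g \<omega>" using C by (simp add: powr_mult mult_ac)
    finally show ?case .
  qed
  show int: "integrable M (\<lambda>\<omega>. norm (v \<omega>) powr p)"
    by (rule Bochner_Integration.integrable_bound[OF g]) (use ae in \<open>auto elim!: eventually_mono\<close>)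
  define A B E where "A = (\<integral>\<omega>. norm (a \<omega>) powr p \<partial>M)" and "B = (\<integral>\<omega>. norm (b \<omega>) powr p \<partial>M)"
    and "E = (\<integral>\<omega>. norm (c \<omega>) powr p \<partial>M)"
  have nn: "A \<ge> 0" "B \<ge> 0" "E \<ge> 0" by (auto simp: A_def B_def E_def)
  have "(\<integral>\<omega>. norm (v \<omega>) powr p \<partial>M) \<le> (\<integral>\<omega>. ?g \<omega> \<partial>M)"
    by (rule integral_mono_AE[OF int g ae])
  also have "\<dots> = (3 * C) powr p * (A + B + E)"
    using a b c by (simp add: A_def B_def E_def)
  finally have "Lp_norm M p v \<le> ((3 * C) powr p * (A + B + E)) powr (1 / p)"
    unfolding Lp_norm_def using p by (intro powr_mono2) auto
  also have "\<dots> = 3 * C * (A + B + E) powr (1 / p)"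
    using C nn p by (simp add: powr_mult powr_powr)
  also have "\<dots> \<le> 3 * C * (3 powr (1 / p) * (A powr (1 / p) + B powr (1 / p) + E powr (1 / p)))"
    using C nn p by (intro mult_left_mono powr_add3_le) auto
  also have "\<dots> \<le> 3 * C * (3 * (A powr (1 / p) + B powr (1 / p) + E powr (1 / p)))"
    using C p powr_mono[of "1 / p" 1 3] by (intro mult_left_mono mult_right_mono) auto
  also have "\<dots> = 9 * C * (Lp_norm M p a + Lp_norm M p b + Lp_norm M p c)"
    by (simp add: Lp_norm_def A_def B_def E_def)
  finally show "Lp_norm M p v \<le> 9 * C * (Lp_norm M p a + Lp_norm M p b + Lp_norm M p c)" .
qed

section \<open>Stagewise correction\<close>

text \<open>
  The admissible corrections form a set that is measurable in \<open>(\<omega>, \<xi>)\<close>: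
  the generating function is jointly measurable, the right-hand side of the estimate is measurable
  in \<open>\<omega>\<close>, and membership in a measurable closed-valued multifunction is a
  measurable condition. Hence pointwise solvability gives a correction that is measurable with
  respect to \<open>G\<close>, the information available at stage \<open>t\<close>.
\<close>

lemma measurable_stage_correction:
  fixes f :: "(nat \<Rightarrow> 'a::euclidean_space) \<Rightarrow> 'w \<Rightarrow> 'b::euclidean_space"
    and z :: "nat \<Rightarrow> 'w \<Rightarrow> 'a"
  assumes fin: "finite_measure M" and sub: "subalgebra M G" and t: "t \<ge> 1"
    and jm: "(\<lambda>(\<zeta>, \<omega>). f \<zeta> \<omega>) \<in> borel_measurable (hist_borel t \<Otimes>\<^sub>M G)"
    and z: "\<And>s. s \<in> {1..<t} \<Longrightarrow> z s \<in> borel_measurable G"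
    and x: "x \<in> borel_measurable G"
    and Y: "measurable_multifunction G Y" "\<And>\<omega>. \<omega> \<in> space G \<Longrightarrow> closed (Y \<omega>)"
    and X: "measurable_multifunction G X" "\<And>\<omega>. \<omega> \<in> space G \<Longrightarrow> closed (X \<omega>)"
    and ex: "AE \<omega> in M. \<exists>\<xi>. f ((\<lambda>s\<in>{1..<t}. z s \<omega>)(t := \<xi>)) \<omega> \<in> Y \<omega> \<and> \<xi> \<in> X \<omega> \<and>
        norm (\<xi> - x \<omega>) \<le> C * (infdist (f ((\<lambda>s\<in>{1..<t}. z s \<omega>)(t := x \<omega>)) \<omega>) (Y \<omega>) + infdist (x \<omega>) (X \<omega>))"
  obtains u where "u \<in> borel_measurable G"
    and "AE \<omega> in M. f ((\<lambda>s\<in>{1..<t}. z s \<omega>)(t := u \<omega>)) \<omega> \<in> Y \<omega> \<and> u \<omega> \<in> X \<omega> \<and>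
        norm (u \<omega> - x \<omega>) \<le> C * (infdist (f ((\<lambda>s\<in>{1..<t}. z s \<omega>)(t := x \<omega>)) \<omega>) (Y \<omega>) + infdist (x \<omega>) (X \<omega>))"
proof -
  have hist_eq: "(\<lambda>s\<in>{1..<t}. z s \<omega>)(t := \<xi>) = (\<lambda>s\<in>{1..t}. if s = t then \<xi> else z s \<omega>)" for \<omega> \<xi>
    using t by (auto simp: fun_eq_iff)
  have hist: "(\<lambda>v. f ((\<lambda>s\<in>{1..<t}. z s (g v))(t := h v)) (g v)) \<in> borel_measurable N"
    if g: "g \<in> measurable N G" and h: "h \<in> borel_measurable N"
    for N :: "'v measure" and g :: "'v \<Rightarrow> 'w" and h
  proof -
    have "(\<lambda>v. \<lambda>s\<in>{1..t}. if s = t then h v else z s (g v)) \<in> measurable N (hist_borel t)"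
    proof (rule measurable_restrict)
      fix s assume s: "s \<in> {1..t}"
      show "(\<lambda>v. if s = t then h v else z s (g v)) \<in> borel_measurable N"
        using h s measurable_compose[OF g z] by (cases "s = t") auto
    qed
    from measurable_compose[OF measurable_Pair[OF this g] jm]
    show ?thesis unfolding hist_eq by simp
  qed
  let ?r = "\<lambda>\<omega>. C * (infdist (f ((\<lambda>s\<in>{1..<t}. z s \<omega>)(t := x \<omega>)) \<omega>) (Y \<omega>) + infdist (x \<omega>) (X \<omega>))"
  let ?P = "G \<Otimes>\<^sub>M (borel :: 'a measure)"
  have r: "?r \<in> borel_measurable G"
    using borel_measurable_infdist_multifunction[OF Y(1) hist[OF measurable_ident_sets[OF refl] x]]
      borel_measurable_infdist_multifunction[OF X(1) x]
    by (intro borel_measurable_times borel_measurable_add borel_measurable_const) auto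
  define B where "B = {v \<in> space ?P. f ((\<lambda>s\<in>{1..<t}. z s (fst v))(t := snd v)) (fst v) \<in> Y (fst v)} \<inter>
      {v \<in> space ?P. snd v \<in> X (fst v)} \<inter> {v \<in> space ?P. norm (snd v - x (fst v)) \<le> ?r (fst v)}"
  have "B \<in> sets ?P"
    unfolding B_def
  proof (intro sets.Int)
    show "{v \<in> space ?P. f ((\<lambda>s\<in>{1..<t}. z s (fst v))(t := snd v)) (fst v) \<in> Y (fst v)} \<in> sets ?P"
      using Y(2) hist[OF measurable_fst measurable_snd]
      by (intro sets_in_closed_multifunction measurable_multifunction_fst Y(1)) (auto simp: space_pair_measure)
    show "{v \<in> space ?P. snd v \<in> X (fst v)} \<in> sets ?P"
      using X(2)
      by (intro sets_in_closed_multifunction measurable_multifunction_fst X(1)) (auto simp: space_pair_measure)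
    have "(\<lambda>v. ?r (fst v)) \<in> borel_measurable ?P" "(\<lambda>v. x (fst v)) \<in> borel_measurable ?P"
      using measurable_compose[OF measurable_fst r] measurable_compose[OF measurable_fst x] by auto
    then show "{v \<in> space ?P. norm (snd v - x (fst v)) \<le> ?r (fst v)} \<in> sets ?P"
      by measurable
  qed
  moreover have mem: "(\<omega>, \<xi>) \<in> B \<longleftrightarrow> f ((\<lambda>s\<in>{1..<t}. z s \<omega>)(t := \<xi>)) \<omega> \<in> Y \<omega> \<and> \<xi> \<in> X \<omega> \<and>
      norm (\<xi> - x \<omega>) \<le> ?r \<omega>" if "\<omega> \<in> space M" for \<omega> \<xi>
    using that sub by (auto simp: B_def space_pair_measure subalgebra_def)
  moreover have "AE \<omega> in M. \<exists>\<xi>. (\<omega>, \<xi>) \<in> B"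
    using ex AE_space by eventually_elim (use mem in blast)
  ultimately obtain u where u: "u \<in> borel_measurable G" "AE \<omega> in M. (\<omega>, u \<omega>) \<in> B"
    using measurable_selection[OF fin sub] by blast
  from u(2) AE_space have "AE \<omega> in M. f ((\<lambda>s\<in>{1..<t}. z s \<omega>)(t := u \<omega>)) \<omega> \<in> Y \<omega> \<and> u \<omega> \<in> X \<omega> \<and>
      norm (u \<omega> - x \<omega>) \<le> ?r \<omega>"
    by eventually_elim (use mem in blast)
  with u(1) show ?thesis by (rule that)
qed

lemma restrict_upd_stage:
  "1 \<le> (t::nat) \<Longrightarrow> (\<lambda>s\<in>{1..<t}. z s \<omega>)(t := z t \<omega>) = (\<lambda>s\<in>{1..t}. z s \<omega>)"
  by (auto simp: fun_eq_iff)

lemma infdist_le_norm: "y \<in> S \<Longrightarrow> infdist v S \<le> norm (v - y)"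
  using infdist_le[of y S v] by (simp add: dist_norm)

text \<open>
  The first \<open>k\<close> stages are repaired while the later ones are kept. Keeping them is
  what makes the next step work: for the partially corrected \<open>z\<close> the residual
  demanded by the recourse condition at stage \<open>k + 1\<close> is the distance of \<open>F z
  (k + 1)\<close> to its target, and Lipschitz continuity compares \<open>F z\<close> with
  \<open>F x\<close> in terms of the corrections made so far. Causality preserves the stages that
  are already feasible.

  The estimate is required against all selections \<open>y\<close> and \<open>w\<close> at once,
  with \<open>z\<close> independent of them; taking the infimum over them turns the right-hand
  side into the distance. The selections \<open>yh\<close> and \<open>wh\<close> ensure that the
  corrections have finite norm.
\<close>

lemma recourse_correction:
  fixes M :: "'w measure"
    and f :: "nat \<Rightarrow> (nat \<Rightarrow> 'a::euclidean_space) \<Rightarrow> 'w \<Rightarrow> 'b::euclidean_space"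
    and F :: "(nat \<Rightarrow> 'w \<Rightarrow> 'a) \<Rightarrow> nat \<Rightarrow> 'w \<Rightarrow> 'b"
  assumes fin: "finite_measure M" and filt: "finite_filtration M \<F> T" and p: "p \<ge> 1"
    and causal: "causal_operator M \<F> T p f F"
    and jm: "jointly_measurable \<F> T f"
    and lip: "lipschitz_operator M \<F> T p F"
    and Y: "\<forall>t\<in>{1..T}. measurable_multifunction (\<F> t) (Y t)"
    and X: "\<forall>t\<in>{1..T}. measurable_multifunction (\<F> t) (X t)"
    and Ycl: "\<forall>t\<in>{1..T}. \<forall>\<omega>\<in>space M. closed (Y t \<omega>)"
    and Xcl: "\<forall>t\<in>{1..T}. \<forall>\<omega>\<in>space M. closed (X t \<omega>)"
    and rec: "complete_subregular_recourse M T f Y X"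
    and yh: "yh \<in> adapted_selections M \<F> T p Y" and wh: "wh \<in> adapted_selections M \<F> T p X"
    and "k \<le> T"
  shows "\<exists>D\<ge>0. \<forall>x\<in>adapted_space M \<F> T p. \<exists>z\<in>adapted_space M \<F> T p.
      (\<forall>t>k. z t = x t) \<and>
      (\<forall>t\<in>{1..k}. (AE \<omega> in M. F z t \<omega> \<in> Y t \<omega>) \<and> (AE \<omega> in M. z t \<omega> \<in> X t \<omega>)) \<and>
      (\<forall>y\<in>adapted_selections M \<F> T p Y. \<forall>w\<in>adapted_selections M \<F> T p X.
         adapted_norm M T p (z - x) \<le> D * (adapted_norm M T p (F x - y) + adapted_norm M T p (x - w)))"
  using \<open>k \<le> T\<close>
proof (induction k)
  case 0
  have "adapted_norm M T p (\<lambda>_ _. 0 :: 'a) = 0"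
    using p by (simp add: adapted_norm_def Lp_norm_def)
  then have N0: "adapted_norm M T p (x - x) = 0" for x :: "nat \<Rightarrow> 'w \<Rightarrow> 'a"
    by (simp add: fun_eq_iff zero_fun_def)
  show ?case
  proof (intro exI[of _ 0] conjI ballI)
    fix x :: "nat \<Rightarrow> 'w \<Rightarrow> 'a" assume "x \<in> adapted_space M \<F> T p"
    then show "\<exists>z\<in>adapted_space M \<F> T p. (\<forall>t>0. z t = x t) \<and>
        (\<forall>t\<in>{1..0}. (AE \<omega> in M. F z t \<omega> \<in> Y t \<omega>) \<and> (AE \<omega> in M. z t \<omega> \<in> X t \<omega>)) \<and>
        (\<forall>y\<in>adapted_selections M \<F> T p Y. \<forall>w\<in>adapted_selections M \<F> T p X.
          adapted_norm M T p (z - x) \<le> 0 * (adapted_norm M T p (F x - y) + adapted_norm M T p (x - w)))"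
      unfolding mult_zero_left by (intro bexI[of _ x] conjI ballI) (simp_all only: N0, simp_all)
  qed simp
next
  case (Suc k)
  let ?A = "adapted_space M \<F> T p :: (nat \<Rightarrow> 'w \<Rightarrow> 'a) set" and ?N = "adapted_norm M T p"
  let ?SY = "adapted_selections M \<F> T p Y" and ?SX = "adapted_selections M \<F> T p X"
  define t where "t = Suc k"
  have t: "1 \<le> t" "t \<le> T" "t \<in> {1..T}" using Suc.prems by (auto simp: t_def)
  have sub: "subalgebra M (\<F> s)" if "s \<in> {1..T}" for s
    using filt that by (simp add: finite_filtration_def)
  have sp: "space (\<F> t) = space M" using sub[OF t(3)] by (simp add: subalgebra_def)
  have meas: "v s \<in> borel_measurable M" "v s \<in> borel_measurable (\<F> s)"
    "integrable M (\<lambda>\<omega>. norm (v s \<omega>) powr p)"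
    if "v \<in> adapted_space M \<F> T p" "s \<in> {1..T}" for v :: "nat \<Rightarrow> 'w \<Rightarrow> 'c::euclidean_space" and s
    using that measurable_from_subalg[OF sub[OF that(2)], of "v s" borel]
    by (auto simp: adapted_space_def Lp_space_def)
  have mono: "v \<in> borel_measurable (\<F> t)" if "v \<in> borel_measurable (\<F> s)" "s \<in> {1..t}"
    for v :: "'w \<Rightarrow> 'c::euclidean_space" and s
  proof (rule measurable_from_subalg[OF _ that(1)])
    show "subalgebra (\<F> t) (\<F> s)"
      using filt that(2) t sub[of s] sp by (auto simp: finite_filtration_def subalgebra_def)
  qed
  have diff: "integrable M (\<lambda>\<omega>. norm (v s \<omega> - v' s \<omega>) powr p)"
    if "v \<in> adapted_space M \<F> T p" "v' \<in> adapted_space M \<F> T p" "s \<in> {1..T}"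
    for v v' :: "nat \<Rightarrow> 'w \<Rightarrow> 'c::euclidean_space" and s
  proof (rule Lp_dominated(1)[OF p, of 1 _ M "v s" "v' s" "\<lambda>_. 0 :: 'c"])
    show "(\<lambda>\<omega>. v s \<omega> - v' s \<omega>) \<in> borel_measurable M"
      using meas(1)[OF that(1,3)] meas(1)[OF that(2,3)] by (rule borel_measurable_diff)
    show "AE \<omega> in M. norm (v s \<omega> - v' s \<omega>) \<le> 1 * (norm (v s \<omega>) + norm (v' s \<omega>) + norm (0 :: 'c))"
      by (intro AE_I2) (simp add: norm_triangle_ineq4)
  qed (use meas(3)[OF that(1,3)] meas(3)[OF that(2,3)] in simp_all)
  have component: "Lp_norm M p (v s) \<le> ?N v" if "s \<in> {1..T}"
    for v :: "nat \<Rightarrow> 'w \<Rightarrow> 'c::euclidean_space" and s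
    unfolding adapted_norm_def using that by (intro member_le_sum) auto
  have F_in: "F v \<in> adapted_space M \<F> T p"
    and F_eq: "\<And>s. s \<in> {1..T} \<Longrightarrow> AE \<omega> in M. F v s \<omega> = f s (\<lambda>r\<in>{1..s}. v r \<omega>) \<omega>" if "v \<in> ?A" for v
    using causal that unfolding causal_operator_def by auto
  obtain L where L: "L \<ge> 0" "\<And>v v'. v \<in> ?A \<Longrightarrow> v' \<in> ?A \<Longrightarrow> ?N (F v - F v') \<le> L * ?N (v - v')"
    using lip unfolding lipschitz_operator_def by blast
  obtain C where "\<forall>t\<in>{1..T}. AE \<omega> in M. \<forall>\<zeta>\<in>(\<Pi>\<^sub>E s\<in>{1..<t}. X s \<omega>). \<forall>\<eta>. \<exists>\<xi>.
        f t (\<zeta>(t := \<xi>)) \<omega> \<in> Y t \<omega> \<and> \<xi> \<in> X t \<omega> \<and>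
        norm (\<xi> - \<eta>) \<le> C * (infdist (f t (\<zeta>(t := \<eta>)) \<omega>) (Y t \<omega>) + infdist \<eta> (X t \<omega>))"
    using rec unfolding complete_subregular_recourse_def by blast
  then have C: "AE \<omega> in M. \<forall>\<zeta>\<in>(\<Pi>\<^sub>E s\<in>{1..<t}. X s \<omega>). \<forall>\<eta>. \<exists>\<xi>.
        f t (\<zeta>(t := \<xi>)) \<omega> \<in> Y t \<omega> \<and> \<xi> \<in> X t \<omega> \<and>
        norm (\<xi> - \<eta>) \<le> C * (infdist (f t (\<zeta>(t := \<eta>)) \<omega>) (Y t \<omega>) + infdist \<eta> (X t \<omega>))"
    using t(3) by blast
  \<comment> \<open>The recourse constant may be negative, whereas the estimates multiply inequalities by it.\<close>
  define C' where "C' = max C 0"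
  obtain D where D: "D \<ge> 0" and IH: "\<forall>x\<in>?A. \<exists>z\<in>?A. (\<forall>t>k. z t = x t) \<and>
      (\<forall>t\<in>{1..k}. (AE \<omega> in M. F z t \<omega> \<in> Y t \<omega>) \<and> (AE \<omega> in M. z t \<omega> \<in> X t \<omega>)) \<and>
      (\<forall>y\<in>?SY. \<forall>w\<in>?SX. ?N (z - x) \<le> D * (?N (F x - y) + ?N (x - w)))"
    using Suc.IH[OF Suc_leD[OF Suc.prems]] by (elim exE conjE) (rule that)
  define D' where "D' = D + 9 * C' * (L * D + 1)"
  have D'0: "D' \<ge> 0" using D L(1) by (simp add: D'_def C'_def)
  have step: "\<exists>z'\<in>?A. (\<forall>s>Suc k. z' s = x s) \<and>
      (\<forall>s\<in>{1..Suc k}. (AE \<omega> in M. F z' s \<omega> \<in> Y s \<omega>) \<and> (AE \<omega> in M. z' s \<omega> \<in> X s \<omega>)) \<and>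
      (\<forall>y\<in>?SY. \<forall>w\<in>?SX. ?N (z' - x) \<le> D' * (?N (F x - y) + ?N (x - w)))" if x: "x \<in> ?A" for x
  proof -
    obtain z where z: "z \<in> ?A" and zx: "\<And>s. s > k \<Longrightarrow> z s = x s"
      and feas: "\<And>s. s \<in> {1..k} \<Longrightarrow> (AE \<omega> in M. F z s \<omega> \<in> Y s \<omega>) \<and> (AE \<omega> in M. z s \<omega> \<in> X s \<omega>)"
      and zle: "\<And>y w. y \<in> ?SY \<Longrightarrow> w \<in> ?SX \<Longrightarrow> ?N (z - x) \<le> D * (?N (F x - y) + ?N (x - w))"
      using bspec[OF IH x] by blast
    \<comment> \<open>Stage \<open>t\<close> is still uncorrected, so the recourse condition is applied with \<open>\<eta> = z t = x t\<close>.\<close>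
    have zt: "z t = x t" using zx by (simp add: t_def)
    have "AE \<omega> in M. \<forall>s\<in>{1..<t}. z s \<omega> \<in> X s \<omega>"
      using feas by (subst AE_ball_countable) (auto simp: t_def less_Suc_eq_le)
    with C have ex: "AE \<omega> in M. \<exists>\<xi>. f t ((\<lambda>s\<in>{1..<t}. z s \<omega>)(t := \<xi>)) \<omega> \<in> Y t \<omega> \<and> \<xi> \<in> X t \<omega> \<and>
        norm (\<xi> - x t \<omega>) \<le> C * (infdist (f t ((\<lambda>s\<in>{1..<t}. z s \<omega>)(t := x t \<omega>)) \<omega>) (Y t \<omega>) + infdist (x t \<omega>) (X t \<omega>))"
    proof eventually_elim
      case (elim \<omega>)
      have "(\<lambda>s\<in>{1..<t}. z s \<omega>) \<in> (\<Pi>\<^sub>E s\<in>{1..<t}. X s \<omega>)"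
        using elim(2) by auto
      with elim(1) show ?case by blast
    qed
    obtain u where u: "u \<in> borel_measurable (\<F> t)"
      and u_ae: "AE \<omega> in M. f t ((\<lambda>s\<in>{1..<t}. z s \<omega>)(t := u \<omega>)) \<omega> \<in> Y t \<omega> \<and> u \<omega> \<in> X t \<omega> \<and>
        norm (u \<omega> - x t \<omega>) \<le> C * (infdist (f t ((\<lambda>s\<in>{1..<t}. z s \<omega>)(t := x t \<omega>)) \<omega>) (Y t \<omega>) + infdist (x t \<omega>) (X t \<omega>))"
    proof (rule measurable_stage_correction[OF fin sub[OF t(3)] t(1) _ _ _ _ _ _ _ ex])
      show "(\<lambda>(\<zeta>, \<omega>). f t \<zeta> \<omega>) \<in> borel_measurable (hist_borel t \<Otimes>\<^sub>M \<F> t)"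
        using jm t(3) by (simp add: jointly_measurable_def)
      show "z s \<in> borel_measurable (\<F> t)" if "s \<in> {1..<t}" for s
        using that t by (intro mono[of _ s] meas(2)[OF z]) auto
      show "x t \<in> borel_measurable (\<F> t)" using meas(2)[OF x t(3)] .
      show "measurable_multifunction (\<F> t) (Y t)" "measurable_multifunction (\<F> t) (X t)"
        using X Y t(3) by blast+
      show "closed (Y t \<omega>)" "closed (X t \<omega>)" if "\<omega> \<in> space (\<F> t)" for \<omega>
        using Xcl Ycl t(3) that sp by blast+
    qed (rule that)
    have u_M: "u \<in> borel_measurable M"
      using measurable_from_subalg[OF sub[OF t(3)] u] .
    have bound: "AE \<omega> in M. norm (u \<omega> - x t \<omega>) \<le>
        C' * (norm (F z t \<omega> - F x t \<omega>) + norm (F x t \<omega> - y t \<omega>) + norm (x t \<omega> - w t \<omega>))"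
      if "y \<in> ?SY" "w \<in> ?SX" for y w
    proof -
      have "AE \<omega> in M. y t \<omega> \<in> Y t \<omega>" "AE \<omega> in M. w t \<omega> \<in> X t \<omega>"
        using that t(3) by (auto simp: adapted_selections_def)
      with u_ae F_eq[OF z t(3)] show ?thesis
      proof eventually_elim
        case (elim \<omega>)
        have "f t ((\<lambda>s\<in>{1..<t}. z s \<omega>)(t := x t \<omega>)) \<omega> = F z t \<omega>"
          using elim(2) restrict_upd_stage[OF t(1), of z \<omega>] by (simp add: zt)
        then have "norm (u \<omega> - x t \<omega>) \<le> C * (infdist (F z t \<omega>) (Y t \<omega>) + infdist (x t \<omega>) (X t \<omega>))"
          using elim(1) by simp
        also have "\<dots> \<le> C' * (infdist (F z t \<omega>) (Y t \<omega>) + infdist (x t \<omega>) (X t \<omega>))"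
          by (intro mult_right_mono add_nonneg_nonneg infdist_nonneg) (simp add: C'_def)
        also have "\<dots> \<le> C' * (norm (F z t \<omega> - F x t \<omega>) + norm (F x t \<omega> - y t \<omega>) + norm (x t \<omega> - w t \<omega>))"
        proof (intro mult_left_mono add_mono)
          show "infdist (x t \<omega>) (X t \<omega>) \<le> norm (x t \<omega> - w t \<omega>)"
            using elim(4) by (rule infdist_le_norm)
          have "infdist (F z t \<omega>) (Y t \<omega>) \<le> norm (F z t \<omega> - y t \<omega>)"
            using elim(3) by (rule infdist_le_norm)
          also have "\<dots> \<le> norm (F z t \<omega> - F x t \<omega>) + norm (F x t \<omega> - y t \<omega>)"
            using norm_triangle_ineq[of "F z t \<omega> - F x t \<omega>" "F x t \<omega> - y t \<omega>"] by simp
          finally show "infdist (F z t \<omega>) (Y t \<omega>) \<le> norm (F z t \<omega> - F x t \<omega>) + norm (F x t \<omega> - y t \<omega>)" .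
        qed (simp add: C'_def)
        finally show ?case .
      qed
    qed
    have sel_A: "y \<in> adapted_space M \<F> T p" if "y \<in> adapted_selections M \<F> T p S"
      for y and S :: "nat \<Rightarrow> 'w \<Rightarrow> 'c::euclidean_space set"
      using that by (simp add: adapted_selections_def)
    have ux_M: "(\<lambda>\<omega>. u \<omega> - x t \<omega>) \<in> borel_measurable M"
      using u_M meas(1)[OF x t(3)] by measurable
    have C'0: "C' \<ge> 0" by (simp add: C'_def)
    have ux: "integrable M (\<lambda>\<omega>. norm (u \<omega> - x t \<omega>) powr p)"
      by (rule Lp_dominated(1)[OF p C'0 ux_M _ _ _ bound[OF yh wh]])
        (intro diff F_in z x t(3) sel_A[OF yh] sel_A[OF wh])+
    have ux_le: "Lp_norm M p (\<lambda>\<omega>. u \<omega> - x t \<omega>) \<le> 9 * C' * (L * D + 1) * (?N (F x - y) + ?N (x - w))"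
      if y: "y \<in> ?SY" and w: "w \<in> ?SX" for y w
    proof -
      let ?\<rho> = "?N (F x - y) + ?N (x - w)"
      have "Lp_norm M p (\<lambda>\<omega>. u \<omega> - x t \<omega>) \<le> 9 * C' * (Lp_norm M p (\<lambda>\<omega>. F z t \<omega> - F x t \<omega>) +
          Lp_norm M p (\<lambda>\<omega>. F x t \<omega> - y t \<omega>) + Lp_norm M p (\<lambda>\<omega>. x t \<omega> - w t \<omega>))"
        by (rule Lp_dominated(2)[OF p C'0 ux_M _ _ _ bound[OF y w]])
          (intro diff F_in z x t(3) sel_A[OF y] sel_A[OF w])+
      also have "\<dots> \<le> 9 * C' * (L * (D * ?\<rho>) + ?N (F x - y) + ?N (x - w))"
      proof (intro mult_left_mono add_mono)
        have "Lp_norm M p (\<lambda>\<omega>. F z t \<omega> - F x t \<omega>) \<le> ?N (F z - F x)"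
          using component[OF t(3), of "F z - F x"] by (simp add: fun_diff_def)
        also have "\<dots> \<le> L * ?N (z - x)" by (rule L(2)[OF z x])
        also have "\<dots> \<le> L * (D * ?\<rho>)" using zle[OF y w] L(1) by (intro mult_left_mono)
        finally show "Lp_norm M p (\<lambda>\<omega>. F z t \<omega> - F x t \<omega>) \<le> L * (D * ?\<rho>)" .
        show "Lp_norm M p (\<lambda>\<omega>. F x t \<omega> - y t \<omega>) \<le> ?N (F x - y)"
          using component[OF t(3), of "F x - y"] by (simp add: fun_diff_def)
        show "Lp_norm M p (\<lambda>\<omega>. x t \<omega> - w t \<omega>) \<le> ?N (x - w)"
          using component[OF t(3), of "x - w"] by (simp add: fun_diff_def)
      qed (simp add: C'_def)
      also have "\<dots> = 9 * C' * (L * D + 1) * ?\<rho>" by (simp add: algebra_simps)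
      finally show ?thesis .
    qed
    define z' where "z' = z(t := u)"
    have z'_A: "z' \<in> ?A"
    proof -
      have "integrable M (\<lambda>\<omega>. norm (u \<omega>) powr p)"
        using ux meas(3)[OF x t(3)] u_M
      proof (intro Lp_dominated(1)[OF p, of 1 u M "\<lambda>\<omega>. u \<omega> - x t \<omega>" "x t" "\<lambda>_. 0 :: 'a"])
        show "AE \<omega> in M. norm (u \<omega>) \<le> 1 * (norm (u \<omega> - x t \<omega>) + norm (x t \<omega>) + norm (0 :: 'a))"
          using norm_triangle_sub[of "u _" "x t _"] by (intro AE_I2) (simp add: add.commute)
      qed auto
      then show ?thesis using z u by (auto simp: z'_def adapted_space_def Lp_space_def)
    qed
    have "AE \<omega> in M. F z' s \<omega> \<in> Y s \<omega>" "AE \<omega> in M. z' s \<omega> \<in> X s \<omega>" if s: "s \<in> {1..Suc k}" for s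
    proof -
      have sT: "s \<in> {1..T}" using s Suc.prems by auto
      consider "s = t" | "s \<in> {1..k}" using s by (force simp: t_def)
      then have "(AE \<omega> in M. F z' s \<omega> \<in> Y s \<omega>) \<and> (AE \<omega> in M. z' s \<omega> \<in> X s \<omega>)"
      proof cases
        case 1
        have "(\<lambda>s\<in>{1..<t}. z s \<omega>)(t := u \<omega>) = (\<lambda>s\<in>{1..t}. z' s \<omega>)" for \<omega>
          using t(1) by (auto simp: z'_def fun_eq_iff)
        then have "AE \<omega> in M. F z' t \<omega> \<in> Y t \<omega>"
          using u_ae F_eq[OF z'_A t(3)] by (auto elim: eventually_elim2)
        moreover have "AE \<omega> in M. z' t \<omega> \<in> X t \<omega>"
          using u_ae by (auto simp: z'_def)
        ultimately show ?thesis using 1 by simp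
      next
        case 2
        then have eq: "(\<lambda>r\<in>{1..s}. z' r \<omega>) = (\<lambda>r\<in>{1..s}. z r \<omega>)" "z' s = z s" for \<omega>
          by (auto simp: z'_def fun_eq_iff t_def)
        from F_eq[OF z'_A sT] F_eq[OF z sT] conjunct1[OF feas[OF 2]]
        have "AE \<omega> in M. F z' s \<omega> \<in> Y s \<omega>"
        proof eventually_elim
          case (elim \<omega>)
          have "F z' s \<omega> = F z s \<omega>" using elim(1,2) eq(1)[of \<omega>] by argo
          then show ?case using elim(3) by simp
        qed
        then show ?thesis using feas[OF 2] eq(2) by simp
      qed
      then show "AE \<omega> in M. F z' s \<omega> \<in> Y s \<omega>" "AE \<omega> in M. z' s \<omega> \<in> X s \<omega>" by auto
    qed
    moreover have "?N (z' - x) \<le> D' * (?N (F x - y) + ?N (x - w))" if "y \<in> ?SY" "w \<in> ?SX" for y w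
    proof -
      have "?N (z' - x) = Lp_norm M p (\<lambda>\<omega>. u \<omega> - x t \<omega>) + (\<Sum>s\<in>{1..T} - {t}. Lp_norm M p ((z' - x) s))"
        unfolding adapted_norm_def using t(3)
        by (subst sum.remove[of _ t]) (auto simp: z'_def fun_diff_def)
      also have "(\<Sum>s\<in>{1..T} - {t}. Lp_norm M p ((z' - x) s)) = (\<Sum>s\<in>{1..T} - {t}. Lp_norm M p ((z - x) s))"
        by (intro sum.cong) (auto simp: z'_def fun_diff_def)
      finally have "?N (z' - x) = Lp_norm M p (\<lambda>\<omega>. u \<omega> - x t \<omega>) +
          (\<Sum>s\<in>{1..T} - {t}. Lp_norm M p ((z - x) s))" .
      also have "\<dots> \<le> Lp_norm M p (\<lambda>\<omega>. u \<omega> - x t \<omega>) + ?N (z - x)"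
        unfolding adapted_norm_def by (intro add_left_mono sum_mono2) auto
      also have "\<dots> \<le> 9 * C' * (L * D + 1) * (?N (F x - y) + ?N (x - w)) + D * (?N (F x - y) + ?N (x - w))"
        by (rule add_mono[OF ux_le[OF that] zle[OF that]])
      also have "\<dots> = D' * (?N (F x - y) + ?N (x - w))"
        by (simp add: D'_def algebra_simps)
      finally show ?thesis .
    qed
    moreover have "\<forall>s>Suc k. z' s = x s" using zx by (simp add: z'_def t_def)
    ultimately show ?thesis using z'_A by blast
  qed
  show ?case by (intro exI[of _ D'] conjI ballI D'0 step)
qed

theorem theorem4p2:
  fixes M :: "'w measure" and \<F> :: "nat \<Rightarrow> 'w measure" and T :: nat and p :: real
    and f :: "nat \<Rightarrow> (nat \<Rightarrow> real ^ 'n) \<Rightarrow> 'w \<Rightarrow> real ^ 'm"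
    and F :: "(nat \<Rightarrow> 'w \<Rightarrow> real ^ 'n) \<Rightarrow> nat \<Rightarrow> 'w \<Rightarrow> real ^ 'm"
    and Y :: "nat \<Rightarrow> 'w \<Rightarrow> (real ^ 'm) set"
    and X :: "nat \<Rightarrow> 'w \<Rightarrow> (real ^ 'n) set"
  assumes "prob_space M"
    and "T \<ge> 1"
    and "finite_filtration M \<F> T"
    and "p \<ge> 1"
    and "causal_operator M \<F> T p f F"
    and "jointly_measurable \<F> T f"
    and "lipschitz_operator M \<F> T p F"
    and "\<forall>t\<in>{1..T}. measurable_multifunction (\<F> t) (Y t)"
    and "\<forall>t\<in>{1..T}. measurable_multifunction (\<F> t) (X t)"
    and "\<forall>t\<in>{1..T}. \<forall>\<omega>\<in>space M. convex (Y t \<omega>) \<and> closed (Y t \<omega>)"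
    and "\<forall>t\<in>{1..T}. \<forall>\<omega>\<in>space M. convex (X t \<omega>) \<and> closed (X t \<omega>)"
    and "complete_subregular_recourse M T f Y X"
  shows "\<forall>xh\<in>adapted_space M \<F> T p.
           (\<forall>t\<in>{1..T}. (AE \<omega> in M. F xh t \<omega> \<in> Y t \<omega>) \<and> (AE \<omega> in M. xh t \<omega> \<in> X t \<omega>)) \<longrightarrow>
           system_subregular_at M \<F> T p F Y X xh"
proof (intro ballI impI)
  let ?A = "adapted_space M \<F> T p :: (nat \<Rightarrow> 'w \<Rightarrow> real ^ 'n) set" and ?N = "adapted_norm M T p"
  let ?SY = "adapted_selections M \<F> T p Y" and ?SX = "adapted_selections M \<F> T p X"
  let ?H = "system_multifunction M \<F> T p F Y X"
  let ?N' = "\<lambda>(v, w). adapted_norm M T p v + adapted_norm M T p w"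
  fix xh assume xh: "xh \<in> ?A"
    and feas: "\<forall>t\<in>{1..T}. (AE \<omega> in M. F xh t \<omega> \<in> Y t \<omega>) \<and> (AE \<omega> in M. xh t \<omega> \<in> X t \<omega>)"
  have sel: "F z \<in> ?SY" "z \<in> ?SX"
    if "z \<in> ?A" "\<forall>t\<in>{1..T}. (AE \<omega> in M. F z t \<omega> \<in> Y t \<omega>) \<and> (AE \<omega> in M. z t \<omega> \<in> X t \<omega>)" for z
    using that assms(5) by (auto simp: adapted_selections_def causal_operator_def)
  have zero: "0 \<in> ?H z"
    if "z \<in> ?A" "\<forall>t\<in>{1..T}. (AE \<omega> in M. F z t \<omega> \<in> Y t \<omega>) \<and> (AE \<omega> in M. z t \<omega> \<in> X t \<omega>)" for z
  proof -
    have "(F z - F z, z - z) \<in> ?H z"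
      using sel[OF that] unfolding system_multifunction_def by blast
    then show ?thesis by (simp add: zero_prod_def)
  qed
  have cl: "\<forall>t\<in>{1..T}. \<forall>\<omega>\<in>space M. closed (Y t \<omega>)" "\<forall>t\<in>{1..T}. \<forall>\<omega>\<in>space M. closed (X t \<omega>)"
    using assms(10,11) by auto
  obtain D where D: "D \<ge> 0" "\<And>x. x \<in> ?A \<Longrightarrow> \<exists>z\<in>?A.
      (\<forall>t\<in>{1..T}. (AE \<omega> in M. F z t \<omega> \<in> Y t \<omega>) \<and> (AE \<omega> in M. z t \<omega> \<in> X t \<omega>)) \<and>
      (\<forall>y\<in>?SY. \<forall>w\<in>?SX. ?N (z - x) \<le> D * (?N (F x - y) + ?N (x - w)))"
    using recourse_correction[OF prob_space.finite_measure[OF assms(1)] assms(3-9) cl assms(12)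
        sel[OF xh feas] order_refl] by blast
  have N_nonneg: "?N v \<ge> 0" for v :: "nat \<Rightarrow> 'w \<Rightarrow> 'c::euclidean_space"
    unfolding adapted_norm_def by (intro sum_nonneg) auto
  have "\<exists>x'\<in>?A. 0 \<in> ?H x' \<and> ennreal (?N (x' - x)) \<le> ennreal (D + 1) * (INF v\<in>?H x. ennreal (?N' v))"
    if x: "x \<in> ?A" for x
  proof -
    obtain z where z: "z \<in> ?A" "\<forall>t\<in>{1..T}. (AE \<omega> in M. F z t \<omega> \<in> Y t \<omega>) \<and> (AE \<omega> in M. z t \<omega> \<in> X t \<omega>)"
      and zle: "\<And>y w. y \<in> ?SY \<Longrightarrow> w \<in> ?SX \<Longrightarrow> ?N (z - x) \<le> D * (?N (F x - y) + ?N (x - w))"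
      using D(2)[OF x] by blast
    \<comment> \<open>Subregularity asks for a strictly positive constant, hence \<open>D + 1\<close>.\<close>
    have "ennreal (?N (z - x) / (D + 1)) \<le> ennreal (?N' v)" if v_in: "v \<in> ?H x" for v
    proof -
      obtain y w where v: "v = (F x - y, x - w)" "y \<in> ?SY" "w \<in> ?SX"
        using v_in unfolding system_multifunction_def by blast
      have "?N (z - x) \<le> (D + 1) * (?N (F x - y) + ?N (x - w))"
        using zle[OF v(2,3)] N_nonneg[of "F x - y"] N_nonneg[of "x - w"] by (simp add: algebra_simps)
      then show ?thesis
        using D(1) v(1) by (intro ennreal_leI) (simp add: divide_le_eq mult.commute)
    qed
    then have "ennreal (?N (z - x) / (D + 1)) \<le> (INF v\<in>?H x. ennreal (?N' v))"
      by (rule INF_greatest)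
    then have "ennreal (D + 1) * ennreal (?N (z - x) / (D + 1)) \<le> ennreal (D + 1) * (INF v\<in>?H x. ennreal (?N' v))"
      by (rule mult_left_mono) simp
    moreover have "ennreal (D + 1) * ennreal (?N (z - x) / (D + 1)) = ennreal (?N (z - x))"
      using D(1) N_nonneg[of "z - x"] by (subst ennreal_mult[symmetric]; simp)
    ultimately show ?thesis using z zero[OF z] by auto
  qed
  \<comment> \<open>The estimate is global, so any radius serves.\<close>
  then show "system_subregular_at M \<F> T p F Y X xh"
    unfolding system_subregular_at_def subregular_at_def
    using xh zero[OF xh feas] D(1)
    by (intro conjI exI[of _ 1] exI[of _ "D + 1"]) auto
qed

end
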